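(* For every $N\ge2$, $$\mathbb E[\widehat\alpha^{\,2}]=\frac{N-1}{N}\alpha^{2},\qquad \mathbb E[\widehat\alpha^{\,2}]-\alpha^2=-\frac{\alpha^{2}}{N},\qquad \mathrm{Var}(\widehat\alpha^{\,2})=\frac{2(N-1)}{N^{2}}\alpha^{4},$$ and consequently $$\mathbb E\bigl[(\widehat\alpha^{\,2}-\alpha^{2})^{2}\bigr]=\frac{2N-1}{N^{2}}\alpha^{4}.$$ Moreover $\mathbb E[\widehat\alpha]=b_N\alpha$, where $\widehat\alpha=\sqrt{\widehat\alpha^{\,2}}$ and $$b_N=\sqrt{\frac2N}\,\frac{\Gamma(N/2)}{\Gamma((N-1)/2)}\in(0,1),$$ and $b_N\uparrow1$ as $N\to\infty$. In particular $\widehat\alpha^{\,2}$ is biased but asymptotically unbiased, and $\widetilde\alpha^{\,2}:=\frac{N}{N-1}\widehat\alpha^{\,2}$ is unbiased for $\alpha^2$ with $\mathrm{Var}(\widetilde\alpha^{\,2})=2\alpha^{4}/(N-1)$.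
   Context: Fix a mesh $h>0$, an integer $m\ge1$ and known Hurst parameters $H_1,\dots,H_m\in(1/2,1)$. Let $B^{H_1},\dots,B^{H_m}$ be independent fractional Brownian motions, i.e. independent centred continuous Gaussian processes with $B^{H_r}(0)=0$ and $\mathbb E[B^{H_r}(t)B^{H_r}(s)]=\frac12(t^{2H_r}+s^{2H_r}-|t-s|^{2H_r})$ for $s,t\ge0$. For $\theta\in\mathbb R$ and $\alpha>0$ set $Z(t)=\theta t+\alpha\sum_{r=1}^m B^{H_r}(t)$, $t_k=kh$, $\mathbf T=(t_1,\dots,t_N)^\top$, $\mathbf Z=(Z(t_1),\dots,Z(t_N))^\top$. Let $\Gamma_H=\sum_{r=1}^m\Gamma_{H_r}$ be the $N\times N$ positive definite matrix with $(\Gamma_{H_r})_{ij}=\frac12(t_i^{2H_r}+t_j^{2H_r}-|t_i-t_j|^{2H_r})$. Put $d_N=\mathbf T^\top\Gamma_H^{-1}\mathbf T>0$ and $$\widehat\alpha^{\,2}=\frac1N\left(\mathbf Z^\top\Gamma_H^{-1}\mathbf Z-\frac{(\mathbf T^\top\Gamma_H^{-1}\mathbf Z)^2}{d_N}\right).$$ In the formula for $b_N$, $\Gamma(\cdot)$ is the Euler Gamma function. *)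

theory Defs
  imports
    "HOL-Probability.Probability"
    "Jordan_Normal_Form.Gauss_Jordan_Elimination"
begin

(* Degenerate (almost surely constant) variables count as Gaussian. *)
definition gaussian_rv :: "'a measure \<Rightarrow> ('a \<Rightarrow> real) \<Rightarrow> bool" where
  "gaussian_rv M X \<longleftrightarrow> X \<in> borel_measurable M \<and>
     ((\<exists>\<mu>. AE \<omega> in M. X \<omega> = \<mu>) \<or>
      (\<exists>\<mu> \<sigma>. \<sigma> > 0 \<and> distributed M lborel X (\<lambda>x. ennreal (normal_density \<mu> \<sigma> x))))"

definition gaussian_process :: "'a measure \<Rightarrow> 'i set \<Rightarrow> ('i \<Rightarrow> 'a \<Rightarrow> real) \<Rightarrow> bool" where
  "gaussian_process M I X \<longleftrightarrow>
     (\<forall>J c. finite J \<and> J \<subseteq> I \<longrightarrow> gaussian_rv M (\<lambda>\<omega>. \<Sum>t\<in>J. c t * X t \<omega>))"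

(* powr takes 0 to 0, so the formula is also right at s = 0, t = 0 and s = t. *)
definition fbm_cov :: "real \<Rightarrow> real \<Rightarrow> real \<Rightarrow> real" where
  "fbm_cov H s t = (s powr (2 * H) + t powr (2 * H) - \<bar>s - t\<bar> powr (2 * H)) / 2"

(* Only the values at times t >= 0 are constrained. *)
definition fractional_brownian_motion ::
    "'a measure \<Rightarrow> real \<Rightarrow> (real \<Rightarrow> 'a \<Rightarrow> real) \<Rightarrow> bool" where
  "fractional_brownian_motion M H B \<longleftrightarrow>
     gaussian_process M {0..} B \<and>
     (AE \<omega> in M. continuous_on {0..} (\<lambda>t. B t \<omega>)) \<and>
     (AE \<omega> in M. B 0 \<omega> = 0) \<and>
     (\<forall>t\<ge>0. prob_space.expectation M (B t) = 0) \<and>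
     (\<forall>s\<ge>0. \<forall>t\<ge>0. prob_space.expectation M (\<lambda>\<omega>. B t \<omega> * B s \<omega>) = fbm_cov H s t)"

(* Independence of whole processes: each path on [0, oo) is a single random element of the
   product sigma-algebra. *)
definition indep_processes ::
    "'a measure \<Rightarrow> ('r \<Rightarrow> real \<Rightarrow> 'a \<Rightarrow> real) \<Rightarrow> 'r set \<Rightarrow> bool" where
  "indep_processes M B R \<longleftrightarrow>
     prob_space.indep_vars M (\<lambda>_. Pi\<^sub>M {0..} (\<lambda>_. borel)) (\<lambda>r \<omega>. \<lambda>t\<in>{0..}. B r t \<omega>) R"

definition mixed_fbm ::
    "nat \<Rightarrow> real \<Rightarrow> real \<Rightarrow> (nat \<Rightarrow> real \<Rightarrow> 'a \<Rightarrow> real) \<Rightarrow> real \<Rightarrow> 'a \<Rightarrow> real" where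
  "mixed_fbm m \<theta> \<alpha> B t \<omega> = \<theta> * t + \<alpha> * (\<Sum>r=1..m. B r t \<omega>)"

(* Vectors and matrices are indexed from 0, so position i carries the time t_(i+1) = (i+1) h. *)
definition grid :: "real \<Rightarrow> nat \<Rightarrow> real" where
  "grid h i = real (Suc i) * h"

definition time_vec :: "real \<Rightarrow> nat \<Rightarrow> real Matrix.vec" where
  "time_vec h N = Matrix.vec N (grid h)"

definition obs_vec :: "real \<Rightarrow> nat \<Rightarrow> (real \<Rightarrow> 'a \<Rightarrow> real) \<Rightarrow> 'a \<Rightarrow> real Matrix.vec" where
  "obs_vec h N Z \<omega> = Matrix.vec N (\<lambda>i. Z (grid h i) \<omega>)"

definition fbm_cov_mat :: "real \<Rightarrow> nat \<Rightarrow> real \<Rightarrow> real Matrix.mat" where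
  "fbm_cov_mat h N H = Matrix.mat N N (\<lambda>(i, j). fbm_cov H (grid h i) (grid h j))"

definition sum_cov_mat :: "nat \<Rightarrow> (nat \<Rightarrow> real) \<Rightarrow> real \<Rightarrow> nat \<Rightarrow> real Matrix.mat" where
  "sum_cov_mat m H h N = Matrix.mat N N (\<lambda>ij. \<Sum>r=1..m. fbm_cov_mat h N (H r) $$ ij)"

definition prec_mat :: "nat \<Rightarrow> (nat \<Rightarrow> real) \<Rightarrow> real \<Rightarrow> nat \<Rightarrow> real Matrix.mat" where
  "prec_mat m H h N = the (mat_inverse (sum_cov_mat m H h N))"

definition d_coeff :: "nat \<Rightarrow> (nat \<Rightarrow> real) \<Rightarrow> real \<Rightarrow> nat \<Rightarrow> real" where
  "d_coeff m H h N =
     Matrix.scalar_prod (time_vec h N) (prec_mat m H h N *\<^sub>v time_vec h N)"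

(* The estimator of alpha^2 as a function of the data vector z alone. *)
definition alpha_sq_est ::
    "nat \<Rightarrow> (nat \<Rightarrow> real) \<Rightarrow> real \<Rightarrow> nat \<Rightarrow> real Matrix.vec \<Rightarrow> real" where
  "alpha_sq_est m H h N z =
     1 / real N *
       (Matrix.scalar_prod z (prec_mat m H h N *\<^sub>v z)
        - (Matrix.scalar_prod (time_vec h N) (prec_mat m H h N *\<^sub>v z))\<^sup>2 / d_coeff m H h N)"

definition alpha_est ::
    "nat \<Rightarrow> (nat \<Rightarrow> real) \<Rightarrow> real \<Rightarrow> nat \<Rightarrow> real Matrix.vec \<Rightarrow> real" where
  "alpha_est m H h N z = sqrt (alpha_sq_est m H h N z)"

definition alpha_sq_est_corrected ::
    "nat \<Rightarrow> (nat \<Rightarrow> real) \<Rightarrow> real \<Rightarrow> nat \<Rightarrow> real Matrix.vec \<Rightarrow> real" where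
  "alpha_sq_est_corrected m H h N z = real N / (real N - 1) * alpha_sq_est m H h N z"

definition b_coeff :: "nat \<Rightarrow> real" where
  "b_coeff N = sqrt (2 / real N) * (Gamma (real N / 2) / Gamma ((real N - 1) / 2))"

end

theory Submission
  imports
    Defs
    "HOL-Real_Asymp.Real_Asymp"
    "HOL-Analysis.Finite_Function_Topology"
    "Jordan_Normal_Form.Determinant"
begin

text \<open>The covariance matrix is nonsingular because the increments of \<open>\<Sigma> B r\<close> on the grid form a
  stationary Gaussian sequence whose covariances tend to 0. Orthonormalising first the contrasts that
  annihilate the drift \<open>T\<close>, and then one more coordinate, gives a matrix \<open>A\<close> with \<open>A \<Gamma> A\<^sup>T = 1\<close>, so
  \<open>\<Gamma>\<close> has inverse \<open>A\<^sup>T A\<close>, and \<open>A T\<close> is supported on the last coordinate. The estimator is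
  therefore \<open>\<alpha>\<^sup>2 / N\<close> times a sum of \<open>N - 1\<close> squares of independent standard normal variables.
  The first two moments come from polarisation; the moment of the square root is read off the Laplace
  transform \<open>(1 + 2 s) powr (- (N - 1) / 2)\<close>, which is that of a Gamma variable. The properties of
  \<open>b_coeff\<close> follow from log-convexity of the Gamma function.\<close>

section \<open>The constant \<open>b_coeff\<close>\<close>

text \<open>Since \<open>prec_mat\<close> is \<open>the\<close> of an optional inverse, nothing is
  known about the estimator until the covariance matrix is shown to be invertible. This obstacle
  shapes the treatment of bilinear forms: positivity of \<open>cov\<close> has to be derived while
  \<open>cov\<close> is only known to be semidefinite. The restriction H < 1 enters there, through
  the lag-n covariance of the increments, a second difference of \<open>n powr (2 * H)\<close>,
  which is of order \<open>n powr (2 * H - 2)\<close>. Gaussianity is carried by characteristic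
  functions throughout. For an orthonormal system of linear combinations the joint characteristic
  function follows from one variance computation, so neither multivariate densities nor the law of a
  sum of squares has to be constructed. Subtracting the squared projection on the drift discards
  exactly the one coordinate that involves \<theta>; this is the source of N - 1 in place of N. A
  square root is not a polynomial, so its expectation is out of reach of the moment computations; it
  is written as a mixture of the functions 1 - exp (- s q), whose expectations the Laplace transform
  supplies.\<close>

lemma Gamma_real_plus1: "x > (0::real) \<Longrightarrow> Gamma (x + 1) = x * Gamma x"
  by (rule Gamma_plus1) (auto elim!: nonpos_Ints_cases)

text \<open>Log-convexity at the midpoint of x and x + 1, exponentiated.\<close>

lemma Gamma_midpoint_le:
  fixes x :: real
  assumes "x > 0"
  shows "(Gamma (x + 1/2))\<^sup>2 \<le> Gamma x * Gamma (x + 1)"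
proof -
  have "(ln \<circ> Gamma) ((1 - 1/2) *\<^sub>R x + (1/2) *\<^sub>R (x + 1)) \<le> (1 - 1/2) * (ln \<circ> Gamma) x + (1/2) * (ln \<circ> Gamma) (x + 1)"
    by (rule convex_onD[OF log_convex_Gamma_real]) (use assms in auto)
  moreover have "(1 - 1/2) *\<^sub>R x + (1/2) *\<^sub>R (x + 1) = x + 1/2"
    by (simp add: field_simps)
  ultimately have "2 * ln (Gamma (x + 1/2)) \<le> ln (Gamma x) + ln (Gamma (x + 1))"
    by simp
  hence "ln ((Gamma (x + 1/2))\<^sup>2) \<le> ln (Gamma x * Gamma (x + 1))"
    using assms Gamma_real_pos[of x] Gamma_real_pos[of "x + 1"]
    by (simp add: ln_mult ln_realpow less_imp_neq[symmetric] del: Gamma_real_pos)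
  thus ?thesis
    using assms Gamma_real_pos[of "x + 1/2"]
    by (subst (asm) ln_le_cancel_iff) (auto intro!: mult_pos_pos zero_less_power simp del: Gamma_real_pos)
qed

text \<open>The upper bound is the midpoint inequality at x, where
  \<open>Gamma (x + 1) = x * Gamma x\<close>. The lower bound is the same inequality at x - 1/2; for
  x \<le> 1/2 that point is not positive, but then the bound has a nonpositive left side.\<close>

lemma Gamma_half_shift_bounds:
  fixes x :: real
  assumes "x > 0"
  shows "(Gamma (x + 1/2) / Gamma x)\<^sup>2 \<le> x"
    and "x - 1/2 \<le> (Gamma (x + 1/2) / Gamma x)\<^sup>2"
proof -
  have G: "Gamma x > 0" "Gamma (x + 1/2) > 0" using assms by auto
  have r: "Gamma (x + 1) = x * Gamma x" using assms by (rule Gamma_real_plus1)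
  show "(Gamma (x + 1/2) / Gamma x)\<^sup>2 \<le> x"
    using Gamma_midpoint_le[OF assms] G unfolding r by (simp add: power_divide field_simps power2_eq_square)
  show "x - 1/2 \<le> (Gamma (x + 1/2) / Gamma x)\<^sup>2"
  proof (cases "x > 1/2")
    case True
    have s: "Gamma (x + 1/2) = (x - 1/2) * Gamma (x - 1/2)"
      using Gamma_real_plus1[of "x - 1/2"] True by (simp add: add.commute)
    have "(x - 1/2) * (Gamma x)\<^sup>2 \<le> (x - 1/2) * (Gamma (x - 1/2) * Gamma (x + 1/2))"
      using Gamma_midpoint_le[of "x - 1/2"] True by (intro mult_left_mono) (auto simp: add.commute)
    also have "\<dots> = (Gamma (x + 1/2))\<^sup>2"
      using s by (simp add: power2_eq_square)
    finally show ?thesis using G by (simp add: power_divide field_simps)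
  next
    case False
    thus ?thesis by (intro order_trans[OF _ zero_le_power2]) auto
  qed
qed

lemma b_coeff_pos: "N \<ge> 2 \<Longrightarrow> b_coeff N > 0"
  unfolding b_coeff_def by (intro mult_pos_pos divide_pos_pos Gamma_real_pos) auto

lemma b_coeff_sq:
  "(b_coeff N)\<^sup>2 = 2 / real N * (Gamma (real N / 2) / Gamma ((real N - 1) / 2))\<^sup>2"
  unfolding b_coeff_def power_mult_distrib by simp

text \<open>With x = (N - 1) / 2 the two Gamma arguments are x and x + 1/2. The upper bound is the
  analytic form of Jensen's inequality (E sqrt Q)^2 \<le> E Q for the estimator Q.\<close>

lemma b_coeff_sq_bounds:
  assumes "N \<ge> 2"
  shows "(real N - 2) / real N \<le> (b_coeff N)\<^sup>2" "(b_coeff N)\<^sup>2 \<le> (real N - 1) / real N"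
proof -
  define x where "x = (real N - 1) / 2"
  have x: "x > 0" "real N = 2 * x + 1" using assms by (auto simp: x_def field_simps)
  have e: "(b_coeff N)\<^sup>2 = 2 / real N * (Gamma (x + 1/2) / Gamma x)\<^sup>2"
    unfolding b_coeff_sq using x by (simp add: field_simps)
  have "2 / real N * (x - 1/2) \<le> (b_coeff N)\<^sup>2" "(b_coeff N)\<^sup>2 \<le> 2 / real N * x"
    unfolding e using Gamma_half_shift_bounds[OF x(1)] by (blast intro: mult_left_mono[OF _ divide_nonneg_nonneg] zero_le_numeral of_nat_0_le_iff)+
  moreover have "2 / real N * (x - 1/2) = (real N - 2) / real N" "2 / real N * x = (real N - 1) / real N"
    unfolding x(2) using x(1) by (simp_all add: divide_simps) (simp_all add: algebra_simps)
  ultimately show "(real N - 2) / real N \<le> (b_coeff N)\<^sup>2" "(b_coeff N)\<^sup>2 \<le> (real N - 1) / real N"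
    by metis+
qed

lemma b_coeff_less_1:
  assumes "N \<ge> 2"
  shows "b_coeff N < 1"
proof -
  have "(b_coeff N)\<^sup>2 < 1\<^sup>2"
    using b_coeff_sq_bounds(2)[OF assms] assms by (simp add: divide_less_eq_1 le_less_trans)
  thus ?thesis by (rule power2_less_imp_less) simp
qed

lemma b_coeff_sq_tendsto: "(\<lambda>N. (b_coeff N)\<^sup>2) \<longlonglongrightarrow> 1"
proof (rule tendsto_sandwich[of "\<lambda>N. (real N - 2) / real N" _ _ "\<lambda>N. (real N - 1) / real N"])
  show "(\<lambda>N. (real N - 2) / real N) \<longlonglongrightarrow> 1" "(\<lambda>N. (real N - 1) / real N) \<longlonglongrightarrow> 1"
    by real_asymp+
qed (auto intro!: eventually_sequentiallyI[of 2] b_coeff_sq_bounds)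

lemma b_coeff_tendsto: "b_coeff \<longlonglongrightarrow> 1"
proof (rule Lim_transform_eventually)
  show "(\<lambda>N. sqrt ((b_coeff N)\<^sup>2)) \<longlonglongrightarrow> 1"
    using tendsto_real_sqrt[OF b_coeff_sq_tendsto] by simp
  show "\<forall>\<^sub>F N in sequentially. sqrt ((b_coeff N)\<^sup>2) = b_coeff N"
    by (intro eventually_sequentiallyI[of 2]) (use b_coeff_pos in \<open>auto simp: less_imp_le\<close>)
qed

text \<open>The intervals that log-convexity gives for N and N + 1 overlap, so they cannot yield
  monotonicity. Over a step of two every Gamma argument moves by 1, so the recurrence applies to all
  Gamma values and the comparison becomes one of rational functions.\<close>

lemma b_coeff_ratio_step:
  assumes "N \<ge> 2"
  shows "(b_coeff (N + 3))\<^sup>2 / (b_coeff (N + 2))\<^sup>2 \<le> (b_coeff (N + 1))\<^sup>2 / (b_coeff N)\<^sup>2"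
proof -
  define n where "n = real N"
  have n: "n \<ge> 2" using assms by (simp add: n_def)
  define p q r where "p = Gamma ((n - 1) / 2)" and "q = Gamma (n / 2)" and "r = Gamma ((n + 1) / 2)"
  have pos: "p > 0" "q > 0" "r > 0" using n by (auto simp: p_def q_def r_def)
  have r: "r = (n - 1) / 2 * p"
    unfolding r_def p_def using Gamma_real_plus1[of "(n - 1) / 2"] n by (simp add: field_simps)
  have G2: "Gamma ((n + 2) / 2) = n / 2 * q"
    unfolding q_def using Gamma_real_plus1[of "n / 2"] n by (simp add: field_simps)
  have G3: "Gamma ((n + 3) / 2) = (n + 1) / 2 * r"
    unfolding r_def using Gamma_real_plus1[of "(n + 1) / 2"] n by (simp add: field_simps)
  have b: "(b_coeff N)\<^sup>2 = 2 / n * (q / p)\<^sup>2"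
      "(b_coeff (N + 1))\<^sup>2 = 2 / (n + 1) * (r / q)\<^sup>2"
      "(b_coeff (N + 2))\<^sup>2 = 2 / (n + 2) * ((n / 2 * q) / r)\<^sup>2"
      "(b_coeff (N + 3))\<^sup>2 = 2 / (n + 3) * (((n + 1) / 2 * r) / (n / 2 * q))\<^sup>2"
    unfolding b_coeff_sq G2[symmetric] G3[symmetric]
    by (simp_all add: n_def p_def q_def r_def add_ac)
  \<comment> \<open>The only transcendental quantity left: both ratios are rational multiples of
    \<open>T\<close>, which cancels.\<close>
  define T where "T = p\<^sup>2 * r\<^sup>2 / q ^ 4"
  have T: "T > 0" using pos by (auto simp: T_def)
  have e1: "(b_coeff (N + 1))\<^sup>2 / (b_coeff N)\<^sup>2 = n / (n + 1) * T"
    unfolding b T_def using pos n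
    by (simp add: divide_simps power2_eq_square power4_eq_xxxx)
  have e2: "(b_coeff (N + 3))\<^sup>2 / (b_coeff (N + 2))\<^sup>2
      = (n + 2) / (n + 3) * ((n + 1)\<^sup>2 * (n - 1)\<^sup>2 / n ^ 4) * T"
  proof -
    have "(b_coeff (N + 3))\<^sup>2 / (b_coeff (N + 2))\<^sup>2
        = (n + 2) / (n + 3) * ((n + 1)\<^sup>2 * 4 / n ^ 4) * r ^ 4 / q ^ 4"
      unfolding b using pos n by (simp add: divide_simps power2_eq_square power4_eq_xxxx)
    also have "r ^ 4 = r\<^sup>2 * ((n - 1) / 2 * p)\<^sup>2"
      unfolding r[symmetric] by (simp add: power2_eq_square power4_eq_xxxx)
    finally show ?thesis unfolding T_def by (simp add: power_mult_distrib power_divide)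
  qed
  \<comment> \<open>The inequality between the two rational factors, with denominators
    cleared.\<close>
  have poly: "(n + 2) * (n + 1) ^ 3 * (n - 1)\<^sup>2 \<le> n ^ 5 * (n + 3)"
  proof -
    have "n ^ 5 * (n + 3) - (n + 2) * (n + 1) ^ 3 * (n - 1)\<^sup>2 = 6 * n ^ 3 + 3 * n\<^sup>2 - 3 * n - 2"
      by (simp add: algebra_simps eval_nat_numeral)
    moreover have "n\<^sup>2 \<ge> 2 * n" "n ^ 3 \<ge> 0"
      using n by (auto simp: power2_eq_square)
    ultimately show ?thesis using n by linarith
  qed
  have "(n + 2) / (n + 3) * ((n + 1)\<^sup>2 * (n - 1)\<^sup>2 / n ^ 4) \<le> n / (n + 1)"
  proof -
    have frac: "A / B \<le> n / (n + 1)" if "B > 0" "A * (n + 1) \<le> n * B" for A B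
      using that n by (simp add: field_simps)
    have "(n + 2) * ((n + 1)\<^sup>2 * (n - 1)\<^sup>2) / ((n + 3) * n ^ 4) \<le> n / (n + 1)"
      by (rule frac) (use poly n in \<open>simp_all add: eval_nat_numeral mult_ac\<close>)
    thus ?thesis by simp
  qed
  hence "(n + 2) / (n + 3) * ((n + 1)\<^sup>2 * (n - 1)\<^sup>2 / n ^ 4) * T \<le> n / (n + 1) * T"
    using T by (intro mult_right_mono) auto
  thus ?thesis unfolding e1 e2 .
qed

text \<open>The ratios of consecutive squares decrease along steps of two and tend to 1, so they are at least 1.\<close>
lemma b_coeff_mono: "mono_on {2..} b_coeff"
proof -
  define \<rho> where "\<rho> N = (b_coeff (N + 1))\<^sup>2 / (b_coeff N)\<^sup>2" for N
  have dec: "\<rho> (N + 2) \<le> \<rho> N" if "N \<ge> 2" for N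
    using b_coeff_ratio_step[OF that] by (simp add: \<rho>_def add_ac eval_nat_numeral)
  have lim: "\<rho> \<longlonglongrightarrow> 1"
    unfolding \<rho>_def using tendsto_divide[OF LIMSEQ_ignore_initial_segment[OF b_coeff_sq_tendsto, of 1] b_coeff_sq_tendsto]
    by simp
  have \<rho>_ge: "\<rho> N \<ge> 1" if N: "N \<ge> 2" for N
  proof (rule LIMSEQ_le_const2)
    show "(\<lambda>k. \<rho> (N + 2 * k)) \<longlonglongrightarrow> 1"
      by (rule filterlim_compose[OF lim])
         (auto intro!: filterlim_subseq strict_monoI)
    have "\<rho> (N + 2 * k) \<le> \<rho> N" for k
    proof (induction k)
      case (Suc k)
      with dec[of "N + 2 * k"] N show ?case by (simp add: add_ac)
    qed simp
    thus "\<exists>n0. \<forall>k\<ge>n0. \<rho> (N + 2 * k) \<le> \<rho> N" by blast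
  qed
  have step: "b_coeff N \<le> b_coeff (Suc N)" if N: "N \<ge> 2" for N
  proof (rule power2_le_imp_le)
    show "(b_coeff N)\<^sup>2 \<le> (b_coeff (Suc N))\<^sup>2"
      using \<rho>_ge[OF N] b_coeff_pos[OF N] by (simp add: \<rho>_def)
    show "b_coeff (Suc N) \<ge> 0" using b_coeff_pos[of "Suc N"] N by simp
  qed
  have "b_coeff a \<le> b_coeff b" if "2 \<le> a" "a \<le> b" for a b
    using that(2) by (induction b rule: dec_induct) (use step that(1) in \<open>auto intro: order_trans\<close>)
  thus ?thesis by (auto intro!: mono_onI)
qed

section \<open>Moments of chi and chi-square variables\<close>

text \<open>Euler's integral under the substitution t = c x. It is kept as a nonnegative integral so
  that mass, Laplace transform and square-root moment of a Gamma law can be read off without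
  integrability conditions.\<close>

lemma nn_integral_gamma_kernel:
  fixes a c :: real
  assumes a: "a > 0" and c: "c > 0"
  shows "(\<integral>\<^sup>+x. ennreal (indicator {0..} x * x powr (a - 1) * exp (- (c * x))) \<partial>lborel) = ennreal (Gamma a / c powr a)"
proof -
  let ?f = "\<lambda>t. ennreal (indicator {0..} t * t powr (a - 1) / exp t)"
  have "ennreal (Gamma a) = (\<integral>\<^sup>+t. ?f t \<partial>lborel)"
    by (rule Gamma_conv_nn_integral_real[OF a])
  also have "\<dots> = ennreal \<bar>c\<bar> * (\<integral>\<^sup>+t. ?f (0 + c * t) \<partial>lborel)"
    by (rule nn_integral_real_affine) (use c in auto)
  also have "\<dots> = ennreal c * (\<integral>\<^sup>+x. ennreal (c powr (a - 1)) * ennreal (indicator {0..} x * x powr (a - 1) * exp (- (c * x))) \<partial>lborel)"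
  proof (intro arg_cong2[where f = "(*)"] nn_integral_cong)
    fix t :: real
    show "?f (0 + c * t) = ennreal (c powr (a - 1)) * ennreal (indicator {0..} t * t powr (a - 1) * exp (- (c * t)))"
      using c by (cases "t \<ge> 0") (simp_all add: zero_le_mult_iff powr_mult exp_minus field_simps flip: ennreal_mult)
  qed (use c in simp)
  also have "\<dots> = ennreal (c powr a) * (\<integral>\<^sup>+x. ennreal (indicator {0..} x * x powr (a - 1) * exp (- (c * x))) \<partial>lborel)"
    using c powr_mult_base[of c "a - 1"] by (subst nn_integral_cmult) (simp_all add: mult.assoc[symmetric] flip: ennreal_mult)
  finally have eq: "ennreal (c powr a) * (\<integral>\<^sup>+x. ennreal (indicator {0..} x * x powr (a - 1) * exp (- (c * x))) \<partial>lborel) = ennreal (Gamma a)"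
    by simp
  have "ennreal (Gamma a / c powr a) = ennreal (1 / c powr a) * (ennreal (c powr a) * (\<integral>\<^sup>+x. ennreal (indicator {0..} x * x powr (a - 1) * exp (- (c * x))) \<partial>lborel))"
    unfolding eq using a c by (simp flip: ennreal_mult)
  also have "\<dots> = (\<integral>\<^sup>+x. ennreal (indicator {0..} x * x powr (a - 1) * exp (- (c * x))) \<partial>lborel)"
    using c by (simp add: mult.assoc[symmetric] flip: ennreal_mult)
  finally show ?thesis ..
qed

section \<open>Square-root moments from Laplace transforms\<close>

definition sqrt_kernel :: "real \<Rightarrow> real \<Rightarrow> real" where
  "sqrt_kernel q s = indicator {0..} s * s powr (- 3/2) * (1 - exp (- (s * q)))"

lemma measurable_sqrt_kernel[measurable (raw)]:
  assumes [measurable]: "f \<in> borel_measurable M" "g \<in> borel_measurable M"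
  shows "(\<lambda>x. sqrt_kernel (f x) (g x)) \<in> borel_measurable M"
  unfolding sqrt_kernel_def by measurable

text \<open>Substitution of q s for s. The integral on the right is \<open>2 * sqrt pi\<close>, but
  its value is never computed: it is enough that it is finite and nonzero.\<close>

lemma sqrt_kernel_scale:
  assumes "q \<ge> 0"
  shows "(\<integral>\<^sup>+s. ennreal (sqrt_kernel q s) \<partial>lborel) = ennreal (sqrt q) * (\<integral>\<^sup>+s. ennreal (sqrt_kernel 1 s) \<partial>lborel)"
proof (cases "q = 0")
  case True
  thus ?thesis by (simp add: sqrt_kernel_def)
next
  case False
  hence q: "q > 0" using assms by simp
  have "(\<integral>\<^sup>+s. ennreal (sqrt_kernel 1 s) \<partial>lborel) = ennreal \<bar>q\<bar> * (\<integral>\<^sup>+s. ennreal (sqrt_kernel 1 (0 + q * s)) \<partial>lborel)"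
    by (rule nn_integral_real_affine) (use q in auto)
  also have "\<dots> = ennreal q * (\<integral>\<^sup>+s. ennreal (q powr (-3/2)) * ennreal (sqrt_kernel q s) \<partial>lborel)"
  proof (intro arg_cong2[where f = "(*)"] nn_integral_cong)
    fix s :: real
    show "ennreal (sqrt_kernel 1 (0 + q * s)) = ennreal (q powr (-3/2)) * ennreal (sqrt_kernel q s)"
      using q by (cases "s \<ge> 0") (simp_all add: sqrt_kernel_def zero_le_mult_iff powr_mult mult_ac flip: ennreal_mult)
  qed (use q in simp)
  also have "\<dots> = ennreal (q powr (-1/2)) * (\<integral>\<^sup>+s. ennreal (sqrt_kernel q s) \<partial>lborel)"
    using q powr_mult_base[of q "-3/2"] by (subst nn_integral_cmult) (simp_all add: mult.assoc[symmetric] flip: ennreal_mult)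
  finally have "ennreal (sqrt q) * (\<integral>\<^sup>+s. ennreal (sqrt_kernel 1 s) \<partial>lborel)
      = (ennreal (sqrt q) * ennreal (q powr (-1/2))) * (\<integral>\<^sup>+s. ennreal (sqrt_kernel q s) \<partial>lborel)"
    by (simp add: mult.assoc)
  also have "ennreal (sqrt q) * ennreal (q powr (-1/2)) = 1"
    using q by (simp add: powr_half_sqrt[symmetric] powr_add[symmetric] flip: ennreal_mult)
  finally show ?thesis by simp
qed

text \<open>Near 0 the factor 1 - exp (- s) \<le> s softens the singularity to
  \<open>s powr (-1/2)\<close>; beyond 1 the factor is at most 1 and \<open>s powr (-3/2)\<close> is
  integrable.\<close>

lemma sqrt_kernel_finite: "(\<integral>\<^sup>+s. ennreal (sqrt_kernel 1 s) \<partial>lborel) < \<infinity>"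
proof -
  have "(\<integral>\<^sup>+s. ennreal (sqrt_kernel 1 s) \<partial>lborel)
      \<le> (\<integral>\<^sup>+s. ennreal (indicator {0..1} s * s powr (-1/2)) + ennreal (indicator {1..} s * s powr (-3/2)) \<partial>lborel)"
  proof (intro nn_integral_mono)
    fix s :: real
    have e: "1 - exp (- s) \<le> s" using exp_ge_add_one_self[of "- s"] by simp
    have "sqrt_kernel 1 s \<le> indicator {0..1} s * s powr (-1/2) + indicator {1..} s * s powr (-3/2)"
    proof (cases "s > 0 \<and> s \<le> 1")
      case True
      have "s powr (-3/2) * (1 - exp (- s)) \<le> s powr (-3/2) * s" using e by (intro mult_left_mono) auto
      also have "\<dots> = s powr (-1/2)" using powr_mult_base[of s "-3/2"] True by (simp add: mult.commute)
      finally show ?thesis using True by (auto simp: sqrt_kernel_def indicator_def intro: add_increasing2)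
    next
      case False
      have "s powr (-3/2) * (1 - exp (- s)) \<le> s powr (-3/2) * 1" by (intro mult_left_mono) auto
      thus ?thesis using False by (auto simp: sqrt_kernel_def indicator_def)
    qed
    thus "ennreal (sqrt_kernel 1 s) \<le> ennreal (indicator {0..1} s * s powr (-1/2)) + ennreal (indicator {1..} s * s powr (-3/2))"
      by (simp add: ennreal_leI flip: ennreal_plus)
  qed
  also have "\<dots> = ennreal (1 powr (-1/2 + 1) / (-1/2 + 1)) + ennreal (- (1 powr (-3/2 + 1)) / (-3/2 + 1))"
    using nn_integral_has_integral_lebesgue[OF _ has_integral_powr_from_0[of "-1/2" 1]]
      nn_integral_has_integral_lebesgue[OF _ has_integral_powr_to_inf[of "-3/2" 1]]
    by (subst nn_integral_add) auto
  also have "\<dots> < \<infinity>" by (simp flip: ennreal_plus)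
  finally show ?thesis .
qed

text \<open>The kernel is strictly positive on (0, 1), which is not a null set.\<close>

lemma sqrt_kernel_neq_0: "(\<integral>\<^sup>+s. ennreal (sqrt_kernel 1 s) \<partial>lborel) \<noteq> 0"
proof
  assume "(\<integral>\<^sup>+s. ennreal (sqrt_kernel 1 s) \<partial>lborel) = 0"
  hence "AE s in lborel. ennreal (sqrt_kernel 1 s) = 0"
    by (subst (asm) nn_integral_0_iff_AE) auto
  hence "AE s in lborel. s \<notin> {0<..<1::real}"
    by eventually_elim (auto simp: sqrt_kernel_def indicator_def)
  hence "emeasure lborel {0<..<1::real} = 0"
    by (subst (asm) AE_iff_measurable[of "{0<..<1}"]) auto
  thus False by simp
qed

text \<open>A nonnegative variable enters \<open>sqrt q * const = \<integral> (1 - exp (- s q)) s^(-3/2) ds\<close> only through its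
  Laplace transform.\<close>
lemma nn_integral_sqrt_eq_if_laplace_eq:
  assumes "prob_space M1" "prob_space M2"
    and [measurable]: "Q1 \<in> borel_measurable M1" "Q2 \<in> borel_measurable M2"
    and nonneg: "\<And>x. 0 \<le> Q1 x" "\<And>x. 0 \<le> Q2 x"
    and laplace: "\<And>s. s \<ge> 0 \<Longrightarrow> (\<integral>x. exp (- (s * Q1 x)) \<partial>M1) = (\<integral>x. exp (- (s * Q2 x)) \<partial>M2)"
  shows "(\<integral>\<^sup>+x. ennreal (sqrt (Q1 x)) \<partial>M1) = (\<integral>\<^sup>+x. ennreal (sqrt (Q2 x)) \<partial>M2)"
proof -
  let ?c = "\<integral>\<^sup>+s. ennreal (sqrt_kernel 1 s) \<partial>lborel"
  have rep: "(\<integral>\<^sup>+x. ennreal (sqrt (Q x)) \<partial>M) * ?c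
      = (\<integral>\<^sup>+s. ennreal (indicator {0..} s * s powr (- 3/2) * (1 - (\<integral>x. exp (- (s * Q x)) \<partial>M))) \<partial>lborel)"
    if M: "prob_space M" and [measurable]: "Q \<in> borel_measurable M" and Q: "\<And>x. 0 \<le> Q x"
    for M :: "'x measure" and Q
  proof -
    interpret prob_space M by (rule M)
    interpret P: pair_sigma_finite M lborel ..
    have "(\<integral>\<^sup>+x. ennreal (sqrt (Q x)) \<partial>M) * ?c = (\<integral>\<^sup>+x. ennreal (sqrt (Q x)) * ?c \<partial>M)"
      by (rule nn_integral_multc[symmetric]) measurable
    also have "\<dots> = (\<integral>\<^sup>+x. \<integral>\<^sup>+s. ennreal (sqrt_kernel (Q x) s) \<partial>lborel \<partial>M)"
      by (intro nn_integral_cong sqrt_kernel_scale[symmetric] Q)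
    also have "\<dots> = (\<integral>\<^sup>+s. \<integral>\<^sup>+x. ennreal (sqrt_kernel (Q x) s) \<partial>M \<partial>lborel)"
      by (rule P.Fubini'[symmetric]) measurable
    also have "\<dots> = (\<integral>\<^sup>+s. ennreal (indicator {0..} s * s powr (- 3/2) * (1 - (\<integral>x. exp (- (s * Q x)) \<partial>M))) \<partial>lborel)"
    proof (intro nn_integral_cong)
      fix s :: real
      show "(\<integral>\<^sup>+x. ennreal (sqrt_kernel (Q x) s) \<partial>M)
          = ennreal (indicator {0..} s * s powr (- 3/2) * (1 - (\<integral>x. exp (- (s * Q x)) \<partial>M)))"
      proof (cases "s \<ge> 0")
        case True
        have int: "integrable M (\<lambda>x. exp (- (s * Q x)))"
          by (rule integrable_const_bound[of _ 1]) (use True Q in auto)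
        have "(\<integral>\<^sup>+x. ennreal (sqrt_kernel (Q x) s) \<partial>M) = ennreal (\<integral>x. sqrt_kernel (Q x) s \<partial>M)"
          by (rule nn_integral_eq_integral)
             (use int Q True in \<open>auto simp: sqrt_kernel_def[abs_def]\<close>)
        also have "(\<integral>x. sqrt_kernel (Q x) s \<partial>M) = indicator {0..} s * s powr (- 3/2) * (1 - (\<integral>x. exp (- (s * Q x)) \<partial>M))"
          using int by (simp add: sqrt_kernel_def prob_space)
        finally show ?thesis .
      qed (simp add: sqrt_kernel_def)
    qed
    finally show ?thesis .
  qed
  have "(\<integral>\<^sup>+x. ennreal (sqrt (Q1 x)) \<partial>M1) * ?c = (\<integral>\<^sup>+x. ennreal (sqrt (Q2 x)) \<partial>M2) * ?c"
    unfolding rep[OF assms(1,3) nonneg(1)] rep[OF assms(2,4) nonneg(2)]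
    by (intro nn_integral_cong) (simp add: laplace indicator_def)
  \<comment> \<open>Cancelling a factor in \<open>ennreal\<close> is sound only when it is neither 0
    nor infinite.\<close>
  thus ?thesis
    using sqrt_kernel_finite sqrt_kernel_neq_0 by (auto simp: ennreal_mult_cancel_left mult.commute[of _ ?c])
qed

text \<open>The law of \<open>Q\<close> is not identified. A Gamma law with shape a and scale 2 has
  the same Laplace transform, hence the same square-root moment, and for it the moment is an Euler
  integral.\<close>

lemma nn_integral_sqrt_of_gamma_laplace:
  assumes M: "prob_space M" and Q: "Q \<in> borel_measurable M" "\<And>x. 0 \<le> Q x"
    and a: "a > 0"
    and laplace: "\<And>s. s \<ge> 0 \<Longrightarrow> (\<integral>x. exp (- (s * Q x)) \<partial>M) = (1 + 2 * s) powr (- a)"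
  shows "(\<integral>\<^sup>+x. ennreal (sqrt (Q x)) \<partial>M) = ennreal (sqrt 2 * Gamma (a + 1/2) / Gamma a)"
proof -
  \<comment> \<open>Density of the Gamma law with shape a and rate 1/2, the chi-square law with 2 a
    degrees of freedom.\<close>
  define f where "f x = indicator {0..} x * x powr (a - 1) * exp (- (1/2 * x)) / (2 powr a * Gamma a)" for x :: real
  have f0: "f x \<ge> 0" for x using a by (simp add: f_def)
  have [measurable]: "f \<in> borel_measurable borel" unfolding f_def by measurable
  let ?R = "density lborel (\<lambda>x. ennreal (f x))"
  have G: "Gamma a > 0" using a by simp
  \<comment> \<open>Used three times: a' = a, c = 1/2 for the total mass; a' = a, c = 1/2 + s for
    the Laplace transform; a' = a + 1/2, c = 1/2 for the square root.\<close>
  have I: "(\<integral>\<^sup>+x. ennreal (g x) \<partial>?R) = ennreal (Gamma a' / c powr a' / (2 powr a * Gamma a))"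
    if g: "\<And>x. x > 0 \<Longrightarrow> g x = x powr (a' - a) * exp (- ((c - 1/2) * x))"
      and [measurable]: "g \<in> borel_measurable borel" and pos: "a' > 0" "c > 0" for g a' c
  proof -
    have "(\<integral>\<^sup>+x. ennreal (g x) \<partial>?R) = (\<integral>\<^sup>+x. ennreal (f x) * ennreal (g x) \<partial>lborel)"
      by (rule nn_integral_density) measurable
    also have "\<dots> = (\<integral>\<^sup>+x. ennreal (1 / (2 powr a * Gamma a)) * ennreal (indicator {0..} x * x powr (a' - 1) * exp (- (c * x))) \<partial>lborel)"
    proof (intro nn_integral_cong)
      fix x :: real
      have "f x * g x = 1 / (2 powr a * Gamma a) * (indicator {0..} x * x powr (a' - 1) * exp (- (c * x)))" if "x > 0"
      proof -
        have "x powr (a - 1) * x powr (a' - a) = x powr (a' - 1)" by (simp flip: powr_add)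
        moreover have "exp (- (1/2 * x)) * exp (- ((c - 1/2) * x)) = exp (- (c * x))"
          by (simp add: algebra_simps flip: exp_add)
        ultimately show ?thesis using that unfolding f_def g[OF that] by (simp add: field_simps)
      qed
      moreover have "f x = 0" "indicator {0..} x * x powr (a' - 1) = 0" if "\<not> x > 0"
        using that by (cases "x = 0"; simp add: f_def)+
      ultimately show "ennreal (f x) * ennreal (g x)
          = ennreal (1 / (2 powr a * Gamma a)) * ennreal (indicator {0..} x * x powr (a' - 1) * exp (- (c * x)))"
        using G f0[of x] by (cases "x > 0") (simp_all flip: ennreal_mult')
    qed
    also have "\<dots> = ennreal (1 / (2 powr a * Gamma a)) * ennreal (Gamma a' / c powr a')"
      by (subst nn_integral_cmult) (simp_all only: nn_integral_gamma_kernel[OF pos], measurable)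
    also have "\<dots> = ennreal (Gamma a' / c powr a' / (2 powr a * Gamma a))"
      using G pos by (simp add: mult.commute flip: ennreal_mult)
    finally show ?thesis .
  qed
  have "emeasure ?R (space ?R) = (\<integral>\<^sup>+x. ennreal 1 \<partial>?R)" by simp
  also have "\<dots> = ennreal (Gamma a / (1/2) powr a / (2 powr a * Gamma a))"
    by (rule I) (use a in auto)
  also have "\<dots> = 1" using G by (simp add: powr_divide)
  finally have R: "prob_space ?R" by (rule prob_spaceI)
  \<comment> \<open>The absolute value is there because nonnegativity is demanded at every point,
    whereas the density makes x nonnegative only almost surely.\<close>
  have laplaceR: "(\<integral>x. exp (- (s * \<bar>x\<bar>)) \<partial>?R) = (1 + 2 * s) powr (- a)" if s: "s \<ge> 0" for s
  proof (rule integral_eq_nn_integral[THEN trans])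
    have "(\<integral>\<^sup>+x. ennreal (exp (- (s * \<bar>x\<bar>))) \<partial>?R)
        = ennreal (Gamma a / (1/2 + s) powr a / (2 powr a * Gamma a))"
      by (rule I) (use a s in auto)
    also have "Gamma a / (1/2 + s) powr a / (2 powr a * Gamma a) = 1 / (2 powr a * (1/2 + s) powr a)"
      using G by simp
    also have "2 powr a * (1/2 + s) powr a = (1 + 2 * s) powr a"
      using s by (simp add: algebra_simps flip: powr_mult)
    finally show "enn2real (\<integral>\<^sup>+x. ennreal (exp (- (s * \<bar>x\<bar>))) \<partial>?R) = (1 + 2 * s) powr (- a)"
      by (simp add: powr_minus_divide)
  qed auto
  have "(\<integral>\<^sup>+x. ennreal (sqrt (Q x)) \<partial>M) = (\<integral>\<^sup>+x. ennreal (sqrt \<bar>x\<bar>) \<partial>?R)"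
    by (rule nn_integral_sqrt_eq_if_laplace_eq[OF M R])
       (use Q laplace laplaceR in auto)
  also have "\<dots> = ennreal (Gamma (a + 1/2) / (1/2) powr (a + 1/2) / (2 powr a * Gamma a))"
    by (rule I) (use a in \<open>auto simp: powr_half_sqrt\<close>)
  also have "(1/2 :: real) powr (a + 1/2) = 1 / (2 powr a * sqrt 2)"
    by (simp add: powr_add powr_divide powr_half_sqrt)
  also have "Gamma (a + 1/2) / (1 / (2 powr a * sqrt 2)) / (2 powr a * Gamma a) = sqrt 2 * Gamma (a + 1/2) / Gamma a"
    using G by (simp add: field_simps)
  finally show ?thesis .
qed


text \<open>The joint characteristic function of n independent standard normal variables. One
  condition carries both normality and independence, in the form in which orthonormal combinations
  of a Gaussian sequence supply it.\<close>

definition std_gaussian_family :: "'a measure \<Rightarrow> nat \<Rightarrow> (nat \<Rightarrow> 'a \<Rightarrow> real) \<Rightarrow> bool" where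
  "std_gaussian_family M n Y \<longleftrightarrow> (\<forall>i<n. Y i \<in> borel_measurable M) \<and>
     (\<forall>u. (CLINT \<omega>|M. iexp (\<Sum>i<n. u i * Y i \<omega>)) = complex_of_real (exp (- (\<Sum>i<n. (u i)\<^sup>2) / 2)))"

text \<open>Up to the factor \<sigma>, the integrand against Lebesgue measure is a centred normal
  density of variance 1 / (1 + 2 s), so the integral is \<sigma>.\<close>

lemma std_normal_exp_sq:
  fixes s :: real
  assumes "s \<ge> 0"
  shows "(\<integral>g. exp (- (s * g\<^sup>2)) \<partial>std_normal_distribution) = (1 + 2 * s) powr (- 1/2)"
proof -
  define \<sigma> where "\<sigma> = 1 / sqrt (1 + 2 * s)"
  have \<sigma>: "\<sigma> > 0" "\<sigma>\<^sup>2 = 1 / (1 + 2 * s)" using assms by (auto simp: \<sigma>_def power_divide)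
  have eq: "std_normal_density g * exp (- (s * g\<^sup>2)) = \<sigma> * normal_density 0 \<sigma> g" for g
  proof -
    have "- g\<^sup>2 / 2 - s * g\<^sup>2 = - (g - 0)\<^sup>2 / (2 * \<sigma>\<^sup>2)"
      using assms unfolding \<sigma>(2) by (simp add: field_simps)
    hence e: "exp (- g\<^sup>2 / 2) * exp (- (s * g\<^sup>2)) = exp (- (g - 0)\<^sup>2 / (2 * \<sigma>\<^sup>2))"
      by (simp flip: exp_add)
    have "\<sigma> * (1 / sqrt (2 * pi * \<sigma>\<^sup>2)) = 1 / sqrt (2 * pi)"
      using \<sigma>(1) by (simp add: real_sqrt_mult)
    hence "\<sigma> * normal_density 0 \<sigma> g = 1 / sqrt (2 * pi) * exp (- (g - 0)\<^sup>2 / (2 * \<sigma>\<^sup>2))"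
      unfolding normal_density_def by (metis mult.assoc)
    thus ?thesis
      unfolding e[symmetric] by (simp add: normal_density_def)
  qed
  have "(\<integral>g. exp (- (s * g\<^sup>2)) \<partial>std_normal_distribution) = (\<integral>g. std_normal_density g * exp (- (s * g\<^sup>2)) \<partial>lborel)"
    by (subst integral_density) auto
  also have "\<dots> = \<sigma>" unfolding eq using \<sigma> by simp
  also have "\<sigma> = (1 + 2 * s) powr (- 1/2)"
    using assms by (simp add: \<sigma>_def powr_minus_divide powr_half_sqrt)
  finally show ?thesis .
qed

text \<open>Coordinates are integrated out one at a time: \<open>exp (- s y\<^sup>2)\<close> is the characteristic function of an
  independent standard normal variable \<open>g\<close> at \<open>sqrt (2 s) y\<close>, so by Fubini the factor \<open>exp (- s (Y k)\<^sup>2)\<close>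
  may be traded for a random frequency \<open>sqrt (2 s) g\<close> in direction \<open>k\<close>.\<close>
lemma std_gaussian_family_laplace_aux:
  assumes M: "prob_space M" and Y: "std_gaussian_family M n Y" and s: "s \<ge> 0" and k: "k \<le> n"
  shows "(CLINT \<omega>|M. of_real (exp (- (s * (\<Sum>i<k. (Y i \<omega>)\<^sup>2)))) * iexp (\<Sum>i\<in>{k..<n}. u i * Y i \<omega>))
    = of_real ((1 + 2 * s) powr (- real k / 2) * exp (- (\<Sum>i\<in>{k..<n}. (u i)\<^sup>2) / 2))"
  using k
\<comment> \<open>The mixed form, Laplace in the first k coordinates and Fourier in the others, is
  what makes the induction close; \<open>u\<close> varies because its entry k is replaced by
  \<open>sqrt (2 * s) * g\<close>.\<close>
proof (induction k arbitrary: u)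
  case 0
  thus ?case using Y s by (simp add: std_gaussian_family_def atLeast0LessThan)
next
  case (Suc k)
  interpret prob_space M by (rule M)
  interpret N: real_distribution std_normal_distribution by (rule real_dist_normal_dist)
  interpret P: pair_prob_space std_normal_distribution M ..
  have [measurable]: "Y i \<in> borel_measurable M" if "i < n" for i
    using Y that by (auto simp: std_gaussian_family_def)
  define F where "F g \<omega> = of_real (exp (- (s * (\<Sum>i<k. (Y i \<omega>)\<^sup>2))))
      * iexp (\<Sum>i\<in>{k..<n}. (u(k := sqrt (2 * s) * g)) i * Y i \<omega>)" for g \<omega>
  have split: "{k..<n} = insert k {Suc k..<n}" using Suc.prems by auto
  have F: "F g \<omega> = of_real (exp (- (s * (\<Sum>i<k. (Y i \<omega>)\<^sup>2)))) *
      iexp (\<Sum>i\<in>{Suc k..<n}. u i * Y i \<omega>) * iexp (sqrt (2 * s) * Y k \<omega> * g)" for g \<omega>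
    unfolding F_def split by (simp add: sum.insert exp_add[symmetric] algebra_simps)
  have inner: "(CLINT g|std_normal_distribution. F g \<omega>)
      = of_real (exp (- (s * (\<Sum>i<Suc k. (Y i \<omega>)\<^sup>2)))) * iexp (\<Sum>i\<in>{Suc k..<n}. u i * Y i \<omega>)" for \<omega>
  proof -
    have "(CLINT g|std_normal_distribution. iexp (sqrt (2 * s) * Y k \<omega> * g))
        = char std_normal_distribution (sqrt (2 * s) * Y k \<omega>)"
      by (simp add: char_def)
    also have "\<dots> = of_real (exp (- (s * (Y k \<omega>)\<^sup>2)))"
      using s by (simp add: char_std_normal_distribution power_mult_distrib)
    finally have "(CLINT g|std_normal_distribution. F g \<omega>) = of_real (exp (- (s * (\<Sum>i<k. (Y i \<omega>)\<^sup>2)))) *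
        iexp (\<Sum>i\<in>{Suc k..<n}. u i * Y i \<omega>) * of_real (exp (- (s * (Y k \<omega>)\<^sup>2)))"
      unfolding F by (subst integral_mult_right_zero) simp
    moreover have "exp (- (s * (\<Sum>i<Suc k. (Y i \<omega>)\<^sup>2))) = exp (- (s * (\<Sum>i<k. (Y i \<omega>)\<^sup>2))) * exp (- (s * (Y k \<omega>)\<^sup>2))"
      by (simp add: distrib_left flip: exp_add)
    ultimately show ?thesis by (simp only: of_real_mult mult_ac)
  qed
  have [measurable]: "(\<lambda>\<omega>. \<Sum>i<k. (Y i \<omega>)\<^sup>2) \<in> borel_measurable M"
      "(\<lambda>\<omega>. \<Sum>i\<in>{Suc k..<n}. u i * Y i \<omega>) \<in> borel_measurable M" "Y k \<in> borel_measurable M"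
    using Suc.prems by (auto intro!: borel_measurable_sum)
  have meas: "case_prod F \<in> borel_measurable (std_normal_distribution \<Otimes>\<^sub>M M)"
    unfolding F by measurable
  have "integrable (std_normal_distribution \<Otimes>\<^sub>M M) (case_prod F)"
    by (rule P.integrable_const_bound[OF _ meas, of 1])
       (use s in \<open>auto simp: F norm_mult intro!: AE_I2 mult_nonneg_nonneg sum_nonneg\<close>)
  from P.Fubini_integral[OF this]
  have "(CLINT \<omega>|M. of_real (exp (- (s * (\<Sum>i<Suc k. (Y i \<omega>)\<^sup>2)))) * iexp (\<Sum>i\<in>{Suc k..<n}. u i * Y i \<omega>))
      = (CLINT g|std_normal_distribution. CLINT \<omega>|M. F g \<omega>)"
    unfolding inner .
  also have "\<dots> = (CLINT g|std_normal_distribution. of_real ((1 + 2 * s) powr (- real k / 2) *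
      exp (- (\<Sum>i\<in>{k..<n}. ((u(k := sqrt (2 * s) * g)) i)\<^sup>2) / 2)))"
    unfolding F_def using Suc by (subst Suc.IH) auto
  also have "\<dots> = of_real (\<integral>g. (1 + 2 * s) powr (- real k / 2) * exp (- (\<Sum>i\<in>{Suc k..<n}. (u i)\<^sup>2) / 2) * exp (- (s * g\<^sup>2)) \<partial>std_normal_distribution)"
  proof -
    have "(\<Sum>i\<in>{k..<n}. ((u(k := sqrt (2 * s) * g)) i)\<^sup>2) = 2 * s * g\<^sup>2 + (\<Sum>i\<in>{Suc k..<n}. (u i)\<^sup>2)" for g
      unfolding split using s by (simp add: power_mult_distrib)
    moreover have "exp (- (2 * s * g\<^sup>2 + c) / 2) = exp (- c / 2) * exp (- (s * g\<^sup>2))" for c g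
      by (simp add: field_simps flip: exp_add)
    ultimately show ?thesis
      by (simp only: integral_complex_of_real mult.assoc)
  qed
  also have "(\<integral>g. (1 + 2 * s) powr (- real k / 2) * exp (- (\<Sum>i\<in>{Suc k..<n}. (u i)\<^sup>2) / 2) * exp (- (s * g\<^sup>2)) \<partial>std_normal_distribution)
     = (1 + 2 * s) powr (- real k / 2) * exp (- (\<Sum>i\<in>{Suc k..<n}. (u i)\<^sup>2) / 2) * (1 + 2 * s) powr (- 1/2)"
    using std_normal_exp_sq[OF s] by simp
  also have "\<dots> = (1 + 2 * s) powr (- real (Suc k) / 2) * exp (- (\<Sum>i\<in>{Suc k..<n}. (u i)\<^sup>2) / 2)"
  proof -
    have "- real (Suc k) / 2 = - real k / 2 + - 1/2" by (simp add: field_simps)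
    thus ?thesis by (simp only: powr_add mult_ac)
  qed
  finally show ?case .
qed

lemma std_gaussian_family_laplace:
  assumes M: "prob_space M" and Y: "std_gaussian_family M n Y" and s: "s \<ge> 0"
  shows "(\<integral>\<omega>. exp (- (s * (\<Sum>i<n. (Y i \<omega>)\<^sup>2))) \<partial>M) = (1 + 2 * s) powr (- (real n / 2))"
proof -
  have "complex_of_real (\<integral>\<omega>. exp (- (s * (\<Sum>i<n. (Y i \<omega>)\<^sup>2))) \<partial>M)
      = of_real ((1 + 2 * s) powr (- (real n / 2)))"
    using std_gaussian_family_laplace_aux[OF M Y s order_refl, of "\<lambda>_. 0"]
    by (simp add: integral_complex_of_real)
  thus ?thesis unfolding of_real_eq_iff .
qed

text \<open>Along the line t u the joint characteristic function is exp (- t^2 / 2), and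
  characteristic functions determine laws.\<close>

lemma std_gaussian_family_lincomb:
  assumes M: "prob_space M" and Y: "std_gaussian_family M n Y" and u: "(\<Sum>i<n. (u i)\<^sup>2) = 1"
  shows "distr M borel (\<lambda>\<omega>. \<Sum>i<n. u i * Y i \<omega>) = std_normal_distribution"
proof (rule Levy_uniqueness[OF _ real_dist_normal_dist])
  interpret prob_space M by (rule M)
  have m: "(\<lambda>\<omega>. \<Sum>i<n. u i * Y i \<omega>) \<in> borel_measurable M"
    using Y by (auto simp: std_gaussian_family_def intro!: borel_measurable_sum)
  thus "real_distribution (distr M borel (\<lambda>\<omega>. \<Sum>i<n. u i * Y i \<omega>))" by simp
  show "char (distr M borel (\<lambda>\<omega>. \<Sum>i<n. u i * Y i \<omega>)) = char std_normal_distribution"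
  proof
    fix t
    have "char (distr M borel (\<lambda>\<omega>. \<Sum>i<n. u i * Y i \<omega>)) t
        = (CLINT \<omega>|M. iexp (\<Sum>i<n. (t * u i) * Y i \<omega>))"
      unfolding char_def using m by (subst integral_distr) (auto simp: sum_distrib_left mult.assoc)
    also have "\<dots> = complex_of_real (exp (- (\<Sum>i<n. (t * u i)\<^sup>2) / 2))"
      using Y unfolding std_gaussian_family_def by metis
    also have "(\<Sum>i<n. (t * u i)\<^sup>2) = t\<^sup>2"
      using u by (simp add: power_mult_distrib flip: sum_distrib_left)
    finally show "char (distr M borel (\<lambda>\<omega>. \<Sum>i<n. u i * Y i \<omega>)) t = char std_normal_distribution t"
      by (simp add: char_std_normal_distribution)
  qed
qed

lemma std_gaussian_family_even_moments:
  assumes M: "prob_space M" and Y: "std_gaussian_family M n Y" and u: "(\<Sum>i<n. (u i)\<^sup>2) = 1"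
  shows "has_bochner_integral M (\<lambda>\<omega>. (\<Sum>i<n. u i * Y i \<omega>) ^ (2 * k)) (fact (2 * k) / (2 ^ k * fact k))"
proof -
  have m: "(\<lambda>\<omega>. \<Sum>i<n. u i * Y i \<omega>) \<in> borel_measurable M"
    using Y by (auto simp: std_gaussian_family_def intro!: borel_measurable_sum)
  show ?thesis
    using std_normal_distribution_even_moments[of k]
    unfolding std_gaussian_family_lincomb[OF assms, symmetric]
    by (simp add: has_bochner_integral_iff integral_distr[OF m] integrable_distr_eq[OF m])
qed

lemma std_gaussian_family_sq_moment:
  assumes M: "prob_space M" and Y: "std_gaussian_family M n Y" and i: "i < n"
  shows "has_bochner_integral M (\<lambda>\<omega>. (Y i \<omega>)\<^sup>2) 1"
proof -
  have "(\<Sum>l<n. (if l = i then 1 else 0 :: real)\<^sup>2) = 1"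
    using i by (simp add: if_distrib[of "\<lambda>x. x\<^sup>2"] cong: if_cong)
  from std_gaussian_family_even_moments[OF M Y this, of 1] show ?thesis
    using i by (simp add: if_distrib[of "\<lambda>x. x * _"] cong: if_cong)
qed

text \<open>Polarisation in place of a product rule for independent variables: for i \<noteq> j both
  (Y i + Y j) / sqrt 2 and (Y i - Y j) / sqrt 2 are standard normal, with fourth moment 3. Their
  fourth powers add up to (Y i)^4 / 2 + (Y j)^4 / 2 + 3 (Y i)^2 (Y j)^2, so 3 times the mixed moment
  is 3 + 3 - 3/2 - 3/2 = 3.\<close>

lemma std_gaussian_family_sq_sq_moment:
  assumes M: "prob_space M" and Y: "std_gaussian_family M n Y" and i: "i < n" and j: "j < n"
  shows "has_bochner_integral M (\<lambda>\<omega>. (Y i \<omega>)\<^sup>2 * (Y j \<omega>)\<^sup>2) (if i = j then 3 else 1)"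
proof -
  have four: "has_bochner_integral M (\<lambda>\<omega>. (Y l \<omega>) ^ 4) 3" if l: "l < n" for l
  proof -
    have "(\<Sum>i<n. (if i = l then 1 else 0 :: real)\<^sup>2) = 1"
      using l by (simp add: if_distrib[of "\<lambda>x. x\<^sup>2"] cong: if_cong)
    from std_gaussian_family_even_moments[OF M Y this, of 2] show ?thesis
      using l by (simp add: if_distrib[of "\<lambda>x. x * _"] fact_numeral cong: if_cong)
  qed
  show ?thesis
  proof (cases "i = j")
    case True
    thus ?thesis using four[OF i] by (simp flip: power_add)
  next
    case False
    have pm: "has_bochner_integral M (\<lambda>\<omega>. (Y i \<omega> / sqrt 2 + \<epsilon> * (Y j \<omega> / sqrt 2)) ^ 4) 3"
      if \<epsilon>: "\<epsilon>\<^sup>2 = 1" for \<epsilon> :: real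
    proof -
      define u where "u l = (if l = i then 1 / sqrt 2 else 0) + (if l = j then \<epsilon> / sqrt 2 else 0)" for l
      have "(u l)\<^sup>2 = (if l = i then 1/2 else 0) + (if l = j then 1/2 else 0)" for l
        using False \<epsilon> by (auto simp: u_def power_divide)
      hence u: "(\<Sum>l<n. (u l)\<^sup>2) = 1" using i j by (simp add: sum.distrib)
      have "(\<Sum>l<n. u l * Y l \<omega>) = Y i \<omega> / sqrt 2 + \<epsilon> * (Y j \<omega> / sqrt 2)" for \<omega>
        using i j by (simp add: u_def distrib_right if_distrib[of "\<lambda>x. x * _"] sum.distrib cong: if_cong)
      with std_gaussian_family_even_moments[OF M Y u, of 2] show ?thesis by (simp add: fact_numeral)
    qed
    have eq: "((Y i \<omega> / sqrt 2 + 1 * (Y j \<omega> / sqrt 2)) ^ 4 + (Y i \<omega> / sqrt 2 + (- 1) * (Y j \<omega> / sqrt 2)) ^ 4)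
        - (1/2) * (Y i \<omega>) ^ 4 - (1/2) * (Y j \<omega>) ^ 4 = 3 * ((Y i \<omega>)\<^sup>2 * (Y j \<omega>)\<^sup>2)" for \<omega>
    proof -
      have scale: "(x / sqrt 2 + \<epsilon> * (y / sqrt 2)) ^ 4 = (x + \<epsilon> * y) ^ 4 / 4" for x y \<epsilon> :: real
      proof -
        have "x / sqrt 2 + \<epsilon> * (y / sqrt 2) = (x + \<epsilon> * y) / sqrt 2" by (simp add: add_divide_distrib)
        moreover have "(sqrt 2 :: real) ^ 4 = 4" using power_mult[of "sqrt 2 :: real" 2 2] by simp
        ultimately show ?thesis by (simp add: power_divide)
      qed
      show ?thesis unfolding scale by (simp add: power4_eq_xxxx power2_eq_square field_simps)
    qed
    have "has_bochner_integral M (\<lambda>\<omega>. 3 * ((Y i \<omega>)\<^sup>2 * (Y j \<omega>)\<^sup>2)) (3 + 3 - (1/2) * 3 - (1/2) * 3)"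
      unfolding eq[symmetric]
      by (intro has_bochner_integral_diff has_bochner_integral_add has_bochner_integral_mult_right pm four i j) auto
    from has_bochner_integral_mult_right[OF this, of "1/3"] show ?thesis using False by simp
  qed
qed

text \<open>The double sum has n diagonal terms 3 and n (n - 1) off-diagonal terms 1, in total n (n
  + 2).\<close>

lemma std_gaussian_family_chi_square_moments:
  assumes M: "prob_space M" and Y: "std_gaussian_family M n Y"
  shows "has_bochner_integral M (\<lambda>\<omega>. \<Sum>i<n. (Y i \<omega>)\<^sup>2) (real n)"
    and "has_bochner_integral M (\<lambda>\<omega>. (\<Sum>i<n. (Y i \<omega>)\<^sup>2)\<^sup>2) (real n * (real n + 2))"
proof -
  have "has_bochner_integral M (\<lambda>\<omega>. \<Sum>i<n. (Y i \<omega>)\<^sup>2) (\<Sum>i<n. 1)"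
    by (intro has_bochner_integral_sum std_gaussian_family_sq_moment[OF M Y]) auto
  thus "has_bochner_integral M (\<lambda>\<omega>. \<Sum>i<n. (Y i \<omega>)\<^sup>2) (real n)" by simp
  have "has_bochner_integral M (\<lambda>\<omega>. \<Sum>i<n. \<Sum>j<n. (Y i \<omega>)\<^sup>2 * (Y j \<omega>)\<^sup>2) (\<Sum>i<n. \<Sum>j<n. if i = j then 3 else 1)"
    by (intro has_bochner_integral_sum std_gaussian_family_sq_sq_moment[OF M Y]) auto
  moreover have "(\<Sum>i<n. \<Sum>j<n. if i = j then 3 else 1) = real n * (real n + 2)"
  proof -
    have "(\<Sum>j<n. if i = j then 3 else (1::real)) = real n + 2" if "i < n" for i
    proof -
      have "(\<Sum>j<n. if i = j then 3 else (1::real)) = (\<Sum>j<n. 1 + (if i = j then 2 else 0))"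
        by (intro sum.cong) auto
      thus ?thesis using that by (simp add: sum.distrib)
    qed
    thus ?thesis by simp
  qed
  ultimately show "has_bochner_integral M (\<lambda>\<omega>. (\<Sum>i<n. (Y i \<omega>)\<^sup>2)\<^sup>2) (real n * (real n + 2))"
    by (simp add: power2_eq_square[of "sum _ _"] sum_product)
qed

text \<open>The Laplace transform is that of a Gamma law of shape n / 2; the square root raises the
  shape by 1/2 in the numerator.\<close>

lemma std_gaussian_family_chi_moment:
  assumes M: "prob_space M" and Y: "std_gaussian_family M n Y" and n: "n > 0"
  shows "has_bochner_integral M (\<lambda>\<omega>. sqrt (\<Sum>i<n. (Y i \<omega>)\<^sup>2))
    (sqrt 2 * Gamma (real n / 2 + 1/2) / Gamma (real n / 2))"
proof (rule has_bochner_integral_nn_integral)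
  have [measurable]: "(\<lambda>\<omega>. \<Sum>i<n. (Y i \<omega>)\<^sup>2) \<in> borel_measurable M"
    using Y by (auto simp: std_gaussian_family_def intro!: borel_measurable_sum)
  show "(\<lambda>\<omega>. sqrt (\<Sum>i<n. (Y i \<omega>)\<^sup>2)) \<in> borel_measurable M" by measurable
  show "(\<integral>\<^sup>+\<omega>. ennreal (sqrt (\<Sum>i<n. (Y i \<omega>)\<^sup>2)) \<partial>M) = ennreal (sqrt 2 * Gamma (real n / 2 + 1/2) / Gamma (real n / 2))"
    by (rule nn_integral_sqrt_of_gamma_laplace[OF M])
       (use n std_gaussian_family_laplace[OF M Y] in \<open>auto intro: sum_nonneg\<close>)
  show "0 \<le> sqrt 2 * Gamma (real n / 2 + 1/2) / Gamma (real n / 2)"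
    using n by (auto intro!: divide_nonneg_pos mult_nonneg_nonneg less_imp_le Gamma_real_pos)
qed (auto intro!: AE_I2 sum_nonneg)

section \<open>Orthonormalisation\<close>

text \<open>Only semidefinite, since the instance is a covariance form whose definiteness is a
  result (\<open>cov_pos\<close>) obtained with these very lemmas.\<close>

locale semi_inner_product =
  fixes b :: "'v::real_vector \<Rightarrow> 'v \<Rightarrow> real"
  assumes linear_right: "linear (b x)"
    and sym: "b x y = b y x"
    and nonneg: "0 \<le> b x x"
begin

lemma linear_left: "linear (\<lambda>x. b x y)"
  using linear_right[of y] sym[of _ y] by simp

lemmas bilinear_simps =
  linear_add[OF linear_right] linear_add[OF linear_left]
  linear_diff[OF linear_right] linear_diff[OF linear_left]
  linear_scale[OF linear_right] linear_scale[OF linear_left]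
  linear_sum[OF linear_right] linear_sum[OF linear_left]
  linear_0[OF linear_right] linear_0[OF linear_left]

lemma null_left:
  assumes "b x x = 0"
  shows "b x y = 0"
proof (rule ccontr)
  assume ne: "b x y \<noteq> 0"
  \<comment> \<open>Since b x x = 0, the value of b on y - t x is affine in t with nonzero slope;
    this t makes it -1.\<close>
  define t where "t = (b y y + 1) / (2 * b x y)"
  have "0 \<le> b (y - t *\<^sub>R x) (y - t *\<^sub>R x)" by (rule nonneg)
  also have "\<dots> = b y y - 2 * t * b x y"
    by (simp add: bilinear_simps assms sym[of y x] algebra_simps)
  also have "\<dots> = -1" using ne by (simp add: t_def field_simps)
  finally show False by simp
qed

lemma subspace_null: "subspace {x. b x x = 0}"
  by (rule subspaceI) (auto simp: bilinear_simps null_left)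

text \<open>Both sides are linear in u and agree on each \<open>e k\<close>. The identity is exact
  and not merely modulo null vectors, because orthonormal vectors span no nonzero null
  vector.\<close>

lemma orthonormal_expansion:
  fixes e :: "nat \<Rightarrow> 'v"
  assumes on: "\<And>i j. i < n \<Longrightarrow> j < n \<Longrightarrow> b (e i) (e j) = (if i = j then 1 else 0)"
    and u: "u \<in> span (e ` {..<n})"
  shows "u = (\<Sum>i<n. b u (e i) *\<^sub>R e i)"
  using u
proof (induction rule: span_induct_alt)
  case base
  show ?case by (simp add: bilinear_simps)
next
  case (step c x y)
  then obtain k where k: "k < n" "x = e k" by auto
  have "(\<Sum>i<n. b x (e i) *\<^sub>R e i) = (\<Sum>i<n. if i = k then e k else 0)"
    using k by (intro sum.cong) (auto simp: on)
  also have "\<dots> = x" using k by simp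
  finally have x: "(\<Sum>i<n. b x (e i) *\<^sub>R e i) = x" .
  have "(\<Sum>i<n. b (c *\<^sub>R x + y) (e i) *\<^sub>R e i)
      = c *\<^sub>R (\<Sum>i<n. b x (e i) *\<^sub>R e i) + (\<Sum>i<n. b y (e i) *\<^sub>R e i)"
    by (simp add: bilinear_simps scaleR_left_distrib sum.distrib scaleR_sum_right)
  thus ?case using x step.IH by simp
qed

lemma parseval:
  fixes e :: "nat \<Rightarrow> 'v"
  assumes on: "\<And>i j. i < n \<Longrightarrow> j < n \<Longrightarrow> b (e i) (e j) = (if i = j then 1 else 0)"
    and u: "u \<in> span (e ` {..<n})"
  shows "b u u = (\<Sum>i<n. (b u (e i))\<^sup>2)"
proof -
  have "b u u = b u (\<Sum>i<n. b u (e i) *\<^sub>R e i)"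
    using orthonormal_expansion[OF on u] by simp
  also have "\<dots> = (\<Sum>i<n. (b u (e i))\<^sup>2)"
    by (simp add: bilinear_simps power2_eq_square)
  finally show ?thesis .
qed

text \<open>The hypothesis is linear independence modulo null vectors, exactly what makes every
  residual normalisable. All initial spans are recorded because later the one of length N - 1 keeps
  the drift out of the first N - 1 vectors.\<close>

lemma gram_schmidt:
  fixes v :: "nat \<Rightarrow> 'v"
  assumes "\<And>k u. k < n \<Longrightarrow> u \<in> span (v ` {..<k}) \<Longrightarrow> 0 < b (v k - u) (v k - u)"
  shows "\<exists>e. (\<forall>i<n. \<forall>j<n. b (e i) (e j) = (if i = j then 1 else 0)) \<and>
             (\<forall>k\<le>n. span (e ` {..<k}) = span (v ` {..<k}))"
  using assms
proof (induction n)
  case 0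
  thus ?case by simp
next
  case (Suc n)
  then obtain e where on: "\<And>i j. i < n \<Longrightarrow> j < n \<Longrightarrow> b (e i) (e j) = (if i = j then 1 else 0)"
    and sp: "\<And>k. k \<le> n \<Longrightarrow> span (e ` {..<k}) = span (v ` {..<k})"
    by (metis less_SucI)
  define u where "u = (\<Sum>j<n. b (v n) (e j) *\<^sub>R e j)"
  define w where "w = v n - u"
  define c where "c = b w w"
  define e' where "e' = e(n := w /\<^sub>R sqrt c)"
  have u: "u \<in> span (e ` {..<n})"
    unfolding u_def by (intro span_sum span_scale span_base) auto
  have c: "c > 0"
    unfolding c_def w_def by (rule Suc.prems) (use u sp in auto)
  have orth: "b w (e i) = 0" if "i < n" for i
  proof -
    have "b u (e i) = (\<Sum>j<n. if j = i then b (v n) (e i) else 0)"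
      unfolding u_def bilinear_simps using that by (intro sum.cong) (auto simp: on)
    thus ?thesis using that by (simp add: w_def bilinear_simps)
  qed
  have "b (e' i) (e' j) = (if i = j then 1 else 0)" if "i < Suc n" "j < Suc n" for i j
    using that on[of i j] orth[of i] orth[of j] c
    by (auto simp: e'_def less_Suc_eq bilinear_simps c_def[symmetric] sym[of "e i" w] field_simps
             simp flip: power2_eq_square)
  moreover have "span (e' ` {..<k}) = span (v ` {..<k})" if "k \<le> Suc n" for k
  proof (cases "k = Suc n")
    case False
    with that have "k \<le> n" by simp
    moreover from this have "e' ` {..<k} = e ` {..<k}" by (auto simp: e'_def)
    ultimately show ?thesis using sp by simp
  next
    case True
    have im: "e' ` {..<k} = insert (w /\<^sub>R sqrt c) (e ` {..<n})" "v ` {..<k} = insert (v n) (v ` {..<n})"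
      unfolding True lessThan_Suc by (auto simp: e'_def)
    have uv: "u \<in> span (v ` {..<n})" using u sp by simp
    have "w /\<^sub>R sqrt c \<in> span (insert (v n) (v ` {..<n}))"
      unfolding w_def by (intro span_scale span_diff) (auto intro: span_base span_mono[THEN subsetD, OF _ uv])
    moreover have "v n \<in> span (insert (w /\<^sub>R sqrt c) (e ` {..<n}))"
    proof -
      have "v n = sqrt c *\<^sub>R (w /\<^sub>R sqrt c) + u" using c by (simp add: w_def)
      also have "\<dots> \<in> span (insert (w /\<^sub>R sqrt c) (e ` {..<n}))"
        by (rule span_add[OF span_scale[OF span_base] span_mono[THEN subsetD, OF _ u]]) auto
      finally show ?thesis .
    qed
    moreover have "e ` {..<n} \<subseteq> span (insert (v n) (v ` {..<n}))"
      using sp[of n] span_superset[of "e ` {..<n}"] span_mono[of "v ` {..<n}" "insert (v n) (v ` {..<n})"] by auto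
    moreover have "v ` {..<n} \<subseteq> span (insert (w /\<^sub>R sqrt c) (e ` {..<n}))"
      using sp[of n] span_superset[of "v ` {..<n}"] span_mono[of "e ` {..<n}" "insert (w /\<^sub>R sqrt c) (e ` {..<n})"] by auto
    ultimately show ?thesis unfolding im span_eq by auto
  qed
  ultimately show ?case by blast
qed

lemma span_image_lessThan:
  fixes v :: "nat \<Rightarrow> 'v"
  assumes "u \<in> span (v ` {..<k})"
  shows "\<exists>a. u = (\<Sum>j<k. a j *\<^sub>R v j)"
  using assms
proof (induction k arbitrary: u)
  case (Suc k)
  then obtain c where "u - c *\<^sub>R v k \<in> span (v ` {..<k})"
    by (auto simp: lessThan_Suc span_breakdown_eq)
  then obtain a where "u - c *\<^sub>R v k = (\<Sum>j<k. a j *\<^sub>R v j)" using Suc.IH by blast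
  hence "u = (\<Sum>j<Suc k. (a(k := c)) j *\<^sub>R v j)" by (simp add: algebra_simps)
  thus ?case by blast
qed simp

text \<open>If some \<open>v k\<close> depended linearly on its predecessors, then by stationarity every \<open>v n\<close> would lie in
  their finite-dimensional span. The coordinates of \<open>v n\<close> in that span tend to 0 while its norm is constant.\<close>
lemma stationary_independent:
  fixes v :: "nat \<Rightarrow> 'v"
  assumes shift: "\<And>i j q. b (v (i + q)) (v (j + q)) = b (v i) (v j)"
    and pos: "0 < b (v 0) (v 0)"
    and decay: "(\<lambda>n. b (v n) (v 0)) \<longlonglongrightarrow> 0"
    and u: "u \<in> span (v ` {..<k})"
  shows "0 < b (v k - u) (v k - u)"
  using u
proof (induction k arbitrary: u rule: less_induct)
  case (less k)
  show ?case
  proof (rule ccontr)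
    assume "\<not> 0 < b (v k - u) (v k - u)"
    with nonneg[of "v k - u"] have null: "b (v k - u) (v k - u) = 0" by simp
    obtain a where a: "u = (\<Sum>j<k. a j *\<^sub>R v j)" using span_image_lessThan less.prems by blast
    \<comment> \<open>The seminorm of a combination depends only on values of \<open>b\<close>,
      which the shift preserves, so the relation at k persists at k + q.\<close>
    have relation: "b (v (k + q) - (\<Sum>j<k. a j *\<^sub>R v (j + q))) (v (k + q) - (\<Sum>j<k. a j *\<^sub>R v (j + q))) = 0" for q
    proof -
      have "b (v (k + q) - (\<Sum>j<k. a j *\<^sub>R v (j + q))) (v (k + q) - (\<Sum>j<k. a j *\<^sub>R v (j + q)))
          = b (v k - (\<Sum>j<k. a j *\<^sub>R v j)) (v k - (\<Sum>j<k. a j *\<^sub>R v j))"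
        by (simp only: bilinear_simps shift)
      thus ?thesis using null a by simp
    qed
    \<comment> \<open>Each of the k predecessors of \<open>v n\<close> is replaced by its
      representative in the span; the errors are null, and null vectors form a subspace.\<close>
    have dep: "\<exists>w \<in> span (v ` {..<k}). b (v n - w) (v n - w) = 0" for n
    proof (induction n rule: less_induct)
      case (less n)
      show ?case
      proof (cases "n < k")
        case True
        thus ?thesis by (intro bexI[of _ "v n"] span_base) (auto simp: bilinear_simps)
      next
        case False
        then obtain q where q: "n = k + q" using le_Suc_ex not_less by blast
        obtain w where w: "\<And>j. j < k \<Longrightarrow> w j \<in> span (v ` {..<k})"
            "\<And>j. j < k \<Longrightarrow> b (v (j + q) - w j) (v (j + q) - w j) = 0"
          using less.IH[of "_ + q"] unfolding q by (metis add_less_cancel_right)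
        have "v n - (\<Sum>j<k. a j *\<^sub>R w j)
            = (v (k + q) - (\<Sum>j<k. a j *\<^sub>R v (j + q))) + (\<Sum>j<k. a j *\<^sub>R (v (j + q) - w j))"
          by (simp add: q scaleR_diff_right sum_subtractf)
        also have "\<dots> \<in> {x. b x x = 0}"
          using relation w(2)
          by (intro subspace_add[OF subspace_null] subspace_sum[OF subspace_null] subspace_scale[OF subspace_null])
             auto
        finally show ?thesis using w(1) by (intro bexI[of _ "\<Sum>j<k. a j *\<^sub>R w j"] span_sum span_scale) auto
      qed
    qed
    \<comment> \<open>The outer induction hypothesis makes the first k vectors independent modulo
      null vectors, as orthonormalising them requires.\<close>
    obtain e where on: "\<And>i j. i < k \<Longrightarrow> j < k \<Longrightarrow> b (e i) (e j) = (if i = j then 1 else 0)"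
      and sp: "\<And>l. l \<le> k \<Longrightarrow> span (e ` {..<l}) = span (v ` {..<l})"
      using gram_schmidt[of k v] less.IH by metis
    have norm: "b (v 0) (v 0) = (\<Sum>i<k. (b (v n) (e i))\<^sup>2)" for n
    proof -
      obtain w where w: "w \<in> span (v ` {..<k})" "b (v n - w) (v n - w) = 0" using dep by blast
      have eq: "b (v n) y = b w y" for y
        using null_left[OF w(2), of y] by (simp add: bilinear_simps)
      have "b (v 0) (v 0) = b (v n) (v n)" using shift[of 0 n 0] by simp
      also have "\<dots> = b w w" using eq sym by metis
      also have "\<dots> = (\<Sum>i<k. (b w (e i))\<^sup>2)" by (rule parseval[OF on]) (use w sp in auto)
      finally show ?thesis by (simp add: eq)
    qed
    \<comment> \<open>By shifting, decay against \<open>v 0\<close> is decay against every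
      \<open>v j\<close>, and then against every linear combination.\<close>
    have decay': "(\<lambda>n. b (v n) w) \<longlonglongrightarrow> 0" if "w \<in> span (range v)" for w
      using that
    proof (induction rule: span_induct_alt)
      case base
      show ?case by (simp add: bilinear_simps)
    next
      case (step c x y)
      then obtain j where j: "x = v j" by blast
      have "(\<lambda>n. b (v (n + j)) (v j)) \<longlonglongrightarrow> 0" using decay shift[of _ j 0] by simp
      hence "(\<lambda>n. b (v n) x) \<longlonglongrightarrow> 0" unfolding j by (rule LIMSEQ_offset)
      from tendsto_add[OF tendsto_mult[OF tendsto_const[of c] this] step.IH]
      show ?case by (simp add: bilinear_simps)
    qed
    have "e i \<in> span (range v)" if "i < k" for i
      using sp[of k] that span_base[of "e i" "e ` {..<k}"] span_mono[of "v ` {..<k}" "range v"] by auto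
    hence "(\<lambda>n. \<Sum>i<k. (b (v n) (e i))\<^sup>2) \<longlonglongrightarrow> (\<Sum>i<k. 0\<^sup>2)"
      by (intro tendsto_sum tendsto_power decay') auto
    with norm have "(\<lambda>n::nat. b (v 0) (v 0)) \<longlonglongrightarrow> 0" by simp
    with pos show False by (simp add: LIMSEQ_const_iff)
  qed
qed

end

section \<open>Linear combinations of a Gaussian sequence\<close>

text \<open>\<open>poly_mapping\<close> serves as the real vector space of finitely supported
  coefficient sequences, so that spans and Gram-Schmidt act on coefficients rather than on random
  variables. The same functional evaluates coefficients on the random sequence and on the
  drift.\<close>

definition lincomb :: "(nat \<Rightarrow> real) \<Rightarrow> (nat \<Rightarrow>\<^sub>0 real) \<Rightarrow> real" where
  "lincomb x p = (\<Sum>i\<in>Poly_Mapping.keys p. Poly_Mapping.lookup p i * x i)"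

lemma lookup_scaleR [simp]: "Poly_Mapping.lookup (c *\<^sub>R p) i = c *\<^sub>R Poly_Mapping.lookup (p :: 'i \<Rightarrow>\<^sub>0 real) i"
proof -
  have "finite {i. c *\<^sub>R Poly_Mapping.lookup p i \<noteq> 0}"
    by (rule finite_subset[OF _ finite_keys[of p]]) (auto simp: in_keys_iff)
  thus ?thesis by (simp add: scaleR_poly_mapping_def)
qed

lemma lincomb_superset:
  assumes "finite S" "Poly_Mapping.keys p \<subseteq> S"
  shows "lincomb x p = (\<Sum>i\<in>S. Poly_Mapping.lookup p i * x i)"
  unfolding lincomb_def using assms by (intro sum.mono_neutral_left) (auto simp: in_keys_iff)

lemma linear_lincomb: "linear (lincomb x)"
proof (rule linearI)
  fix p q :: "nat \<Rightarrow>\<^sub>0 real" and c :: real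
  let ?S = "Poly_Mapping.keys p \<union> Poly_Mapping.keys q"
  have "lincomb x (p + q) = (\<Sum>i\<in>?S. Poly_Mapping.lookup (p + q) i * x i)"
    by (rule lincomb_superset) (auto dest: keys_add[THEN subsetD])
  also have "\<dots> = (\<Sum>i\<in>?S. Poly_Mapping.lookup p i * x i) + (\<Sum>i\<in>?S. Poly_Mapping.lookup q i * x i)"
    by (simp add: lookup_add distrib_right sum.distrib)
  also have "\<dots> = lincomb x p + lincomb x q"
    by (intro arg_cong2[where f = "(+)"] lincomb_superset[symmetric]) auto
  finally show "lincomb x (p + q) = lincomb x p + lincomb x q" .
  have "lincomb x (c *\<^sub>R p) = (\<Sum>i\<in>Poly_Mapping.keys p. Poly_Mapping.lookup (c *\<^sub>R p) i * x i)"
    by (rule lincomb_superset) (auto simp: in_keys_iff)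
  thus "lincomb x (c *\<^sub>R p) = c *\<^sub>R lincomb x p"
    by (simp add: lincomb_def sum_distrib_left mult.assoc)
qed

lemma lincomb_single [simp]: "lincomb x (Poly_Mapping.single i c) = c * x i"
  by (cases "c = 0") (simp_all add: lincomb_def)

text \<open>The simplifier rewrites \<open>Poly_Mapping.single 0 1\<close> to \<open>1\<close>, so
  evaluation is needed in that form as well.\<close>

lemma lincomb_one [simp]: "lincomb x 1 = x 0"
  using lincomb_single[of x 0 1] by simp

lemmas lincomb_simps = linear_add[OF linear_lincomb] linear_diff[OF linear_lincomb]
  linear_scale[OF linear_lincomb] linear_sum[OF linear_lincomb] linear_0[OF linear_lincomb]

lemma lincomb_affine: "lincomb (\<lambda>i. a * x i + c * y i) p = a * lincomb x p + c * lincomb y p"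
  by (simp add: lincomb_def sum.distrib sum_distrib_left algebra_simps)

lemma poly_mapping_sum_singles:
  "(p :: nat \<Rightarrow>\<^sub>0 real) = (\<Sum>i\<in>Poly_Mapping.keys p. Poly_Mapping.lookup p i *\<^sub>R Poly_Mapping.single i 1)"
proof (rule poly_mapping_eqI)
  fix k
  have "Poly_Mapping.lookup (\<Sum>i\<in>S. Poly_Mapping.lookup p i *\<^sub>R Poly_Mapping.single i (1::real)) k
      = (\<Sum>i\<in>S. if i = k then Poly_Mapping.lookup p i else 0)" if "finite S" for S
    using that by (induction S rule: finite_induct) (auto simp: lookup_add lookup_single when_def)
  thus "Poly_Mapping.lookup p k = Poly_Mapping.lookup (\<Sum>i\<in>Poly_Mapping.keys p. Poly_Mapping.lookup p i *\<^sub>R Poly_Mapping.single i 1) k"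
    by (simp add: in_keys_iff)
qed

lemma integrable_mult_of_sq:
  fixes X Y :: "'a \<Rightarrow> real"
  assumes [measurable]: "X \<in> borel_measurable M" "Y \<in> borel_measurable M"
    and "integrable M (\<lambda>\<omega>. (X \<omega>)\<^sup>2)" "integrable M (\<lambda>\<omega>. (Y \<omega>)\<^sup>2)"
  shows "integrable M (\<lambda>\<omega>. X \<omega> * Y \<omega>)"
proof (rule Bochner_Integration.integrable_bound)
  show "integrable M (\<lambda>\<omega>. (X \<omega>)\<^sup>2 + (Y \<omega>)\<^sup>2)" using assms by simp
  have "\<bar>x * y\<bar> \<le> \<bar>x\<^sup>2 + y\<^sup>2\<bar>" for x y :: real
  proof -
    have "2 * (\<bar>x\<bar> * \<bar>y\<bar>) \<le> x\<^sup>2 + y\<^sup>2"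
      using zero_le_power2[of "\<bar>x\<bar> - \<bar>y\<bar>"] by (simp add: power2_diff)
    moreover have "0 \<le> \<bar>x\<bar> * \<bar>y\<bar>" by simp
    ultimately show ?thesis unfolding abs_mult by linarith
  qed
  thus "AE \<omega> in M. norm (X \<omega> * Y \<omega>) \<le> norm ((X \<omega>)\<^sup>2 + (Y \<omega>)\<^sup>2)" by simp
qed measurable

lemma integral_double_sum:
  fixes f :: "'i \<Rightarrow> 'j \<Rightarrow> 'a \<Rightarrow> real"
  assumes "\<And>i j. i \<in> S \<Longrightarrow> j \<in> T \<Longrightarrow> integrable M (f i j)"
  shows "(\<integral>\<omega>. (\<Sum>i\<in>S. \<Sum>j\<in>T. f i j \<omega>) \<partial>M) = (\<Sum>i\<in>S. \<Sum>j\<in>T. integral\<^sup>L M (f i j))"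
proof -
  have "(\<integral>\<omega>. (\<Sum>i\<in>S. \<Sum>j\<in>T. f i j \<omega>) \<partial>M) = (\<Sum>i\<in>S. \<integral>\<omega>. (\<Sum>j\<in>T. f i j \<omega>) \<partial>M)"
    by (intro Bochner_Integration.integral_sum Bochner_Integration.integrable_sum assms)
  also have "\<dots> = (\<Sum>i\<in>S. \<Sum>j\<in>T. integral\<^sup>L M (f i j))"
    by (intro sum.cong refl Bochner_Integration.integral_sum assms)
  finally show ?thesis .
qed

text \<open>Joint Gaussianity through characteristic functions. Frequency 1 suffices because scaling
  \<open>p\<close> produces all others, and degenerate combinations fit the same formula.\<close>

locale centered_gaussian_sequence = prob_space M
  for M :: "'a measure" +
  fixes X :: "nat \<Rightarrow> 'a \<Rightarrow> real"
  assumes measurable_X [measurable]: "X i \<in> borel_measurable M"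
    and integrable_sq: "integrable M (\<lambda>\<omega>. (X i \<omega>)\<^sup>2)"
    and char_lincomb: "(CLINT \<omega>|M. iexp (lincomb (\<lambda>i. X i \<omega>) p))
      = complex_of_real (exp (- expectation (\<lambda>\<omega>. (lincomb (\<lambda>i. X i \<omega>) p)\<^sup>2) / 2))"
begin

definition cov :: "(nat \<Rightarrow>\<^sub>0 real) \<Rightarrow> (nat \<Rightarrow>\<^sub>0 real) \<Rightarrow> real" where
  "cov p q = expectation (\<lambda>\<omega>. lincomb (\<lambda>i. X i \<omega>) p * lincomb (\<lambda>i. X i \<omega>) q)"

lemma measurable_lincomb [measurable]: "(\<lambda>\<omega>. lincomb (\<lambda>i. X i \<omega>) p) \<in> borel_measurable M"
  unfolding lincomb_def by measurable

lemma integrable_lincomb_mult: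
  "integrable M (\<lambda>\<omega>. lincomb (\<lambda>i. X i \<omega>) p * lincomb (\<lambda>i. X i \<omega>) q)"
proof -
  have "integrable M (\<lambda>\<omega>. \<Sum>i\<in>Poly_Mapping.keys p. \<Sum>j\<in>Poly_Mapping.keys q. (Poly_Mapping.lookup p i * Poly_Mapping.lookup q j) * (X i \<omega> * X j \<omega>))"
    by (intro Bochner_Integration.integrable_sum integrable_mult_right integrable_mult_of_sq measurable_X integrable_sq)
  thus ?thesis by (simp add: lincomb_def sum_product mult_ac)
qed

sublocale semi_inner_product cov
proof (rule semi_inner_product.intro)
  fix x y :: "nat \<Rightarrow>\<^sub>0 real"
  show "linear (cov x)"
    by (rule linearI)
       (simp_all add: cov_def lincomb_simps distrib_left integrable_lincomb_mult mult.left_commute)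
  show "cov x y = cov y x" by (simp add: cov_def mult.commute)
  show "0 \<le> cov x x" by (simp add: cov_def)
qed

text \<open>Jointly Gaussian and uncorrelated implies independent: the joint characteristic function
  at u is governed by the variance of the single combination
  \<open>\<Sum>i<n. u i *\<^sub>R e i\<close>, which orthonormality makes the squared length of
  u.\<close>

lemma std_gaussian_family_orthonormal:
  assumes on: "\<And>i j. i < n \<Longrightarrow> j < n \<Longrightarrow> cov (e i) (e j) = (if i = j then 1 else 0)"
  shows "std_gaussian_family M n (\<lambda>i \<omega>. lincomb (\<lambda>k. X k \<omega>) (e i))"
  unfolding std_gaussian_family_def
proof (intro conjI allI impI)
  fix u :: "nat \<Rightarrow> real"
  define p where "p = (\<Sum>i<n. u i *\<^sub>R e i)"
  have "cov p p = (\<Sum>i<n. u i * cov (e i) p)"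
    by (subst (1) p_def) (simp add: linear_sum[OF linear_left] linear_scale[OF linear_left])
  also have "\<dots> = (\<Sum>i<n. u i * (\<Sum>j<n. u j * cov (e i) (e j)))"
    unfolding p_def by (simp add: linear_sum[OF linear_right] linear_scale[OF linear_right])
  also have "\<dots> = (\<Sum>i<n. u i * (\<Sum>j<n. if i = j then u i else 0))"
    using on by (intro sum.cong arg_cong2[where f = "(*)"]) auto
  also have "\<dots> = (\<Sum>i<n. (u i)\<^sup>2)" by (simp add: power2_eq_square)
  finally have c: "expectation (\<lambda>\<omega>. (lincomb (\<lambda>i. X i \<omega>) p)\<^sup>2) = (\<Sum>i<n. (u i)\<^sup>2)"
    by (simp add: cov_def power2_eq_square)
  have "(CLINT \<omega>|M. iexp (\<Sum>i<n. u i * lincomb (\<lambda>k. X k \<omega>) (e i))) = (CLINT \<omega>|M. iexp (lincomb (\<lambda>k. X k \<omega>) p))"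
    by (simp add: p_def lincomb_simps)
  thus "(CLINT \<omega>|M. iexp (\<Sum>i<n. u i * lincomb (\<lambda>k. X k \<omega>) (e i)))
      = complex_of_real (exp (- (\<Sum>i<n. (u i)\<^sup>2) / 2))"
    unfolding char_lincomb c .
qed measurable

text \<open>\<open>w\<close> is the triangular change from values to increments. With k the largest
  index in the support of p and c its coefficient, p = c (w k - u) for some u in the span of the
  earlier increments, which reduces the claim to \<open>stationary_independent\<close>.\<close>

lemma cov_pos:
  assumes w0: "w 0 = Poly_Mapping.single 0 1"
    and w: "\<And>k. w (Suc k) = Poly_Mapping.single (Suc k) 1 - Poly_Mapping.single k 1"
    and shift: "\<And>i j q. cov (w (i + q)) (w (j + q)) = cov (w i) (w j)"
    and pos: "0 < cov (w 0) (w 0)"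
    and decay: "(\<lambda>n. cov (w n) (w 0)) \<longlonglongrightarrow> 0"
    and p: "p \<noteq> 0"
  shows "0 < cov p p"
proof -
  have single: "Poly_Mapping.single i 1 \<in> span (w ` {..i})" for i
  proof (induction i)
    case 0
    show ?case by (auto simp: w0 intro!: span_base)
  next
    case (Suc i)
    have "Poly_Mapping.single (Suc i) 1 = w (Suc i) + Poly_Mapping.single i 1" by (simp add: w)
    also have "\<dots> \<in> span (w ` {..Suc i})"
      by (intro span_add span_base span_mono[THEN subsetD, OF _ Suc]) auto
    finally show ?case .
  qed
  define k where "k = Max (Poly_Mapping.keys p)"
  define c where "c = Poly_Mapping.lookup p k"
  have kp: "k \<in> Poly_Mapping.keys p" using p by (simp add: k_def)
  hence c: "c \<noteq> 0" by (simp add: c_def in_keys_iff)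
  have wk: "Poly_Mapping.single k 1 - w k \<in> span (w ` {..<k})"
  proof (cases k)
    case 0
    thus ?thesis by (simp add: w0)
  next
    case (Suc k')
    thus ?thesis using single[of k'] by (simp add: w lessThan_Suc_atMost)
  qed
  have rest: "(\<Sum>i\<in>Poly_Mapping.keys p - {k}. Poly_Mapping.lookup p i *\<^sub>R Poly_Mapping.single i 1) \<in> span (w ` {..<k})"
  proof (intro span_sum span_scale)
    fix i assume i: "i \<in> Poly_Mapping.keys p - {k}"
    hence "i \<le> k" "i \<noteq> k" by (auto simp: k_def)
    hence "w ` {..i} \<subseteq> w ` {..<k}" by auto
    thus "Poly_Mapping.single i 1 \<in> span (w ` {..<k})" using single[of i] span_mono by blast
  qed
  define u where "u = - ((Poly_Mapping.single k 1 - w k)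
      + (1 / c) *\<^sub>R (\<Sum>i\<in>Poly_Mapping.keys p - {k}. Poly_Mapping.lookup p i *\<^sub>R Poly_Mapping.single i 1))"
  have u: "u \<in> span (w ` {..<k})"
    unfolding u_def by (intro span_neg span_add span_scale wk rest)
  have "p = c *\<^sub>R Poly_Mapping.single k 1 + (\<Sum>i\<in>Poly_Mapping.keys p - {k}. Poly_Mapping.lookup p i *\<^sub>R Poly_Mapping.single i 1)"
    using poly_mapping_sum_singles[of p] kp by (simp add: sum.remove[of "Poly_Mapping.keys p" k] c_def)
  also have "\<dots> = c *\<^sub>R (w k - u)"
    using c by (simp add: u_def algebra_simps)
  finally have "cov p p = c\<^sup>2 * cov (w k - u) (w k - u)"
    by (simp add: linear_scale[OF linear_left] linear_scale[OF linear_right] power2_eq_square)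
  thus ?thesis using stationary_independent[OF shift pos decay u] c by simp
qed

text \<open>The contrasts \<open>X (i + 1) - (i + 2) X 0\<close> do not see the drift; orthonormalising them first and
  adding \<open>X 0\<close> last confines the drift to the last coordinate.\<close>
lemma orthonormal_contrasts:
  assumes pos: "\<And>p. p \<noteq> 0 \<Longrightarrow> 0 < cov p p" and h: "h > 0" and N: "N \<ge> 1"
  obtains e where "\<And>i j. i < N \<Longrightarrow> j < N \<Longrightarrow> cov (e i) (e j) = (if i = j then 1 else 0)"
    and "\<And>i. i < N \<Longrightarrow> Poly_Mapping.keys (e i) \<subseteq> {..<N}"
    and "\<And>i. i < N - 1 \<Longrightarrow> lincomb (grid h) (e i) = 0"
    and "lincomb (grid h) (e (N - 1)) \<noteq> 0"
proof -
  \<comment> \<open>The grid starts at h and not at 0, so \<open>grid h (Suc i)\<close> is i + 2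
    times \<open>grid h 0\<close>; hence the coefficient.\<close>
  define v :: "nat \<Rightarrow> nat \<Rightarrow>\<^sub>0 real" where
    "v i = (if i < N - 1 then Poly_Mapping.single (Suc i) 1 - real (i + 2) *\<^sub>R Poly_Mapping.single 0 1
            else Poly_Mapping.single 0 1)" for i
  have drift: "lincomb (grid h) (v i) = 0" if "i < N - 1" for i
    using that by (simp add: v_def lincomb_simps grid_def)
  have last: "lincomb (grid h) (v (N - 1)) = h"
    by (simp add: v_def grid_def)
  have drift_span: "lincomb (grid h) u = 0" if "u \<in> span (v ` {..<k})" "k \<le> N - 1" for u k
    by (rule linear_eq_0_on_span[OF linear_lincomb _ that(1)]) (use that(2) drift in auto)
  have "v k - u \<noteq> 0" if k: "k < N" and u: "u \<in> span (v ` {..<k})" for k u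
  proof (cases "k = N - 1")
    case True
    thus ?thesis using drift_span[OF u] last h by auto
  next
    case False
    \<comment> \<open>Reads off the coefficient at \<open>Suc k\<close>: it vanishes on the
      predecessors of \<open>v k\<close> and is 1 on \<open>v k\<close>, so \<open>v k\<close> is
      outside their span.\<close>
    define \<delta> where "\<delta> i = (if i = Suc k then 1 else 0 :: real)" for i
    have "lincomb \<delta> u = 0"
      by (rule linear_eq_0_on_span[OF linear_lincomb _ u]) (use False k in \<open>auto simp: v_def lincomb_simps \<delta>_def\<close>)
    moreover have "lincomb \<delta> (v k) = 1"
      using False k by (simp add: v_def lincomb_simps \<delta>_def)
    ultimately show ?thesis by auto
  qed
  hence "0 < cov (v k - u) (v k - u)" if "k < N" "u \<in> span (v ` {..<k})" for k u
    using that pos by blast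
  then obtain e where on: "\<And>i j. i < N \<Longrightarrow> j < N \<Longrightarrow> cov (e i) (e j) = (if i = j then 1 else 0)"
    and sp: "\<And>k. k \<le> N \<Longrightarrow> span (e ` {..<k}) = span (v ` {..<k})"
    using gram_schmidt[of N v] by metis
  have keys_span: "Poly_Mapping.keys u \<subseteq> {..<N}" if "u \<in> span (v ` {..<N})" for u
    using that
  proof (induction rule: span_induct_alt)
    case (step c x y)
    have "Poly_Mapping.keys (v i) \<subseteq> {..<N}" for i
      using N by (auto simp: v_def in_keys_iff lookup_minus lookup_single lookup_one when_def split: if_splits)
    hence "Poly_Mapping.lookup x i = 0" "Poly_Mapping.lookup y i = 0" if "i \<ge> N" for i
      using that step by (auto simp: subset_iff in_keys_iff) (metis not_less)+
    hence "Poly_Mapping.lookup (c *\<^sub>R x + y) i = 0" if "i \<ge> N" for i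
      using that by (simp add: lookup_add)
    thus ?case by (metis in_keys_iff lessThan_iff not_le subsetI)
  qed simp
  have e0: "lincomb (grid h) (e i) = 0" if "i < N - 1" for i
  proof (rule drift_span)
    show "e i \<in> span (v ` {..<N - 1})" using sp[of "N - 1"] that span_base[of "e i" "e ` {..<N - 1}"] by auto
  qed simp
  show thesis
  proof
    \<comment> \<open>Otherwise the drift would vanish on the whole span, which contains
      \<open>v (N - 1)\<close>, where it equals h. Later this says that \<open>d_coeff\<close> is
      nonzero.\<close>
    show "lincomb (grid h) (e (N - 1)) \<noteq> 0"
    proof
      assume "lincomb (grid h) (e (N - 1)) = 0"
      hence "lincomb (grid h) (e i) = 0" if "i < N" for i
        using e0[of i] that by (cases "i = N - 1") auto
      hence zero: "lincomb (grid h) b = 0" if "b \<in> e ` {..<N}" for b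
        using that by blast
      have "v (N - 1) \<in> span (e ` {..<N})"
        using sp[of N] N span_base[of "v (N - 1)" "v ` {..<N}"] by simp
      hence "lincomb (grid h) (v (N - 1)) = 0"
        by (rule linear_eq_0_on_span[OF linear_lincomb, rotated]) (rule zero)
      thus False using last h by simp
    qed
    show "Poly_Mapping.keys (e i) \<subseteq> {..<N}" if "i < N" for i
      by (rule keys_span) (use sp[of N] that span_base[of "e i" "e ` {..<N}"] in simp)
  qed (fact on, fact e0)
qed

end

section \<open>Sums of fractional Brownian motions\<close>

lemma gaussian_rv_standardise:
  assumes M: "prob_space M" and U: "gaussian_rv M U"
  obtains (const) \<mu> where "AE \<omega> in M. U \<omega> = \<mu>"
    | (normal) \<mu> \<sigma> V where "V \<in> borel_measurable M" "distr M borel V = std_normal_distribution"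
      "U = (\<lambda>\<omega>. \<mu> + \<sigma> * V \<omega>)"
proof -
  interpret prob_space M by (rule M)
  show thesis
  proof (cases "\<exists>\<mu>. AE \<omega> in M. U \<omega> = \<mu>")
    case True
    thus thesis using const by blast
  next
    case False
    then obtain \<mu> \<sigma> where \<sigma>: "\<sigma> > 0" and d: "distributed M lborel U (normal_density \<mu> \<sigma>)"
      using U by (auto simp: gaussian_rv_def)
    have V: "distributed M lborel (\<lambda>\<omega>. (U \<omega> - \<mu>) / \<sigma>) std_normal_density"
      using d normal_standard_normal_convert[OF \<sigma>] by simp
    show thesis
    proof (rule normal)
      show "(\<lambda>\<omega>. (U \<omega> - \<mu>) / \<sigma>) \<in> borel_measurable M"
        using V by (auto simp: distributed_def)
      have "distr M borel (\<lambda>\<omega>. (U \<omega> - \<mu>) / \<sigma>) = distr M lborel (\<lambda>\<omega>. (U \<omega> - \<mu>) / \<sigma>)"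
        by (rule distr_cong) auto
      thus "distr M borel (\<lambda>\<omega>. (U \<omega> - \<mu>) / \<sigma>) = std_normal_distribution"
        using distributed_distr_eq_density[OF V] by simp
      show "U = (\<lambda>\<omega>. \<mu> + \<sigma> * ((U \<omega> - \<mu>) / \<sigma>))" using \<sigma> by auto
    qed
  qed
qed

lemma std_normal_moments_of_distr:
  assumes [measurable]: "V \<in> borel_measurable M" and V: "distr M borel V = std_normal_distribution"
  shows "integrable M V" "integral\<^sup>L M V = 0" "integrable M (\<lambda>\<omega>. (V \<omega>)\<^sup>2)" "(\<integral>\<omega>. (V \<omega>)\<^sup>2 \<partial>M) = 1"
  using integrable_std_normal_distribution_moment[of 1] integral_std_normal_distribution_moment_odd[of 1]
    integrable_std_normal_distribution_moment[of 2] std_normal_distribution_even_moments[of 1]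
  unfolding V[symmetric] by (simp_all add: integrable_distr_eq integral_distr)

lemma gaussian_rv_measurable: "gaussian_rv M U \<Longrightarrow> U \<in> borel_measurable M"
  unfolding gaussian_rv_def by (rule conjunct1)

lemma gaussian_rv_integrable:
  assumes M: "prob_space M" and U: "gaussian_rv M U"
  shows "integrable M U" "integrable M (\<lambda>\<omega>. (U \<omega>)\<^sup>2)"
proof -
  interpret prob_space M by (rule M)
  have m [measurable]: "U \<in> borel_measurable M" using U by (rule gaussian_rv_measurable)
  from M U have "integrable M U \<and> integrable M (\<lambda>\<omega>. (U \<omega>)\<^sup>2)"
  proof (cases rule: gaussian_rv_standardise)
    case (const \<mu>)
    have "integrable M U \<longleftrightarrow> integrable M (\<lambda>_. \<mu>)" using const by (intro integrable_cong_AE) auto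
    moreover have "integrable M (\<lambda>\<omega>. (U \<omega>)\<^sup>2) \<longleftrightarrow> integrable M (\<lambda>_. \<mu>\<^sup>2)"
      using const by (intro integrable_cong_AE) auto
    ultimately show ?thesis by simp
  next
    case (normal \<mu> \<sigma> V)
    note mom = std_normal_moments_of_distr[OF normal(1,2)]
    have "(\<mu> + \<sigma> * V \<omega>)\<^sup>2 = \<mu>\<^sup>2 + 2 * \<mu> * \<sigma> * V \<omega> + \<sigma>\<^sup>2 * (V \<omega>)\<^sup>2" for \<omega>
      by (simp add: power2_eq_square algebra_simps)
    thus ?thesis unfolding normal(3) using mom by simp
  qed
  thus "integrable M U" "integrable M (\<lambda>\<omega>. (U \<omega>)\<^sup>2)" by auto
qed

lemma gaussian_rv_char:
  assumes M: "prob_space M" and U: "gaussian_rv M U" and mean: "integral\<^sup>L M U = 0"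
  shows "(CLINT \<omega>|M. iexp (U \<omega>)) = complex_of_real (exp (- (\<integral>\<omega>. (U \<omega>)\<^sup>2 \<partial>M) / 2))"
proof -
  interpret prob_space M by (rule M)
  have m [measurable]: "U \<in> borel_measurable M" using U by (rule gaussian_rv_measurable)
  from M U show ?thesis
  proof (cases rule: gaussian_rv_standardise)
    case (const \<mu>)
    have "integral\<^sup>L M U = (\<integral>_. \<mu> \<partial>M)" using const by (intro integral_cong_AE) auto
    hence "\<mu> = 0" using mean by (simp add: prob_space)
    hence U0: "AE \<omega> in M. U \<omega> = 0" using const by simp
    have "(CLINT \<omega>|M. iexp (U \<omega>)) = (CLINT \<omega>|M. 1)" using U0 by (intro integral_cong_AE) auto
    moreover have "(\<integral>\<omega>. (U \<omega>)\<^sup>2 \<partial>M) = (\<integral>\<omega>. 0 \<partial>M)" using U0 by (intro integral_cong_AE) auto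
    ultimately show ?thesis by (simp add: prob_space)
  next
    case (normal \<mu> \<sigma> V)
    note mom = std_normal_moments_of_distr[OF normal(1,2)]
    have "\<mu> = 0" using mean mom unfolding normal(3) by (simp add: prob_space)
    hence U: "U = (\<lambda>\<omega>. \<sigma> * V \<omega>)" using normal(3) by simp
    have "(CLINT \<omega>|M. iexp (\<sigma> * V \<omega>)) = char (distr M borel V) \<sigma>"
      using normal(1) by (simp add: char_def integral_distr)
    also have "\<dots> = complex_of_real (exp (- (\<sigma>\<^sup>2) / 2))"
      by (simp add: normal(2) char_std_normal_distribution)
    also have "\<sigma>\<^sup>2 = (\<integral>\<omega>. (U \<omega>)\<^sup>2 \<partial>M)"
      unfolding U using mom by (simp add: power_mult_distrib)
    finally show ?thesis unfolding U .
  qed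
qed

text \<open>The second difference behaves like a (a - 1) \<open>n powr (a - 2)\<close>. For a = 2,
  the Hurst parameter 1, it would equal 2 for every n.\<close>

lemma powr_second_difference_tendsto_0:
  fixes a :: real
  assumes "1 < a" "a < 2"
  shows "(\<lambda>n. \<bar>real n + 1\<bar> powr a + \<bar>real n - 1\<bar> powr a - 2 * \<bar>real n\<bar> powr a) \<longlonglongrightarrow> 0"
  using assms by real_asymp

text \<open>Differencing in both arguments removes every term in one time alone; only time
  differences are left.\<close>

lemma fbm_cov_increments:
  "fbm_cov H s' t' - fbm_cov H s' t - fbm_cov H s t' + fbm_cov H s t
    = (\<bar>s' - t\<bar> powr (2 * H) + \<bar>s - t'\<bar> powr (2 * H) - \<bar>s' - t'\<bar> powr (2 * H) - \<bar>s - t\<bar> powr (2 * H)) / 2"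
proof -
  have "(a + c - x) / 2 - (a + d - y) / 2 - (b + c - z) / 2 + (b + d - w) / 2 = (y + z - x - w) / 2"
    for a b c d x y z w :: real by (simp add: field_simps)
  thus ?thesis unfolding fbm_cov_def .
qed

locale fbm_sum = prob_space M
  for M :: "'a measure" +
  fixes m :: nat and H :: "nat \<Rightarrow> real" and B :: "nat \<Rightarrow> real \<Rightarrow> 'a \<Rightarrow> real" and h :: real
  assumes h: "h > 0" and m: "m \<ge> 1"
    and H: "\<And>r. r \<in> {1..m} \<Longrightarrow> 1 / 2 < H r \<and> H r < 1"
    and B: "\<And>r. r \<in> {1..m} \<Longrightarrow> fractional_brownian_motion M (H r) (B r)"
    and indep: "indep_processes M B {1..m}"
begin

lemma gaussian_B:
  assumes r: "r \<in> {1..m}" and J: "finite J" "J \<subseteq> {0..}"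
  shows "gaussian_rv M (\<lambda>\<omega>. \<Sum>t\<in>J. c t * B r t \<omega>)"
proof -
  have "gaussian_process M {0..} (B r)"
    using B[OF r] by (simp add: fractional_brownian_motion_def)
  thus ?thesis using J unfolding gaussian_process_def by simp
qed

lemma B_square_integrable:
  assumes r: "r \<in> {1..m}" and t: "t \<ge> 0"
  shows "B r t \<in> borel_measurable M" "integrable M (B r t)" "integrable M (\<lambda>\<omega>. (B r t \<omega>)\<^sup>2)"
proof -
  have g: "gaussian_rv M (B r t)" using gaussian_B[OF r, of "{t}" "\<lambda>_. 1"] t by simp
  show "B r t \<in> borel_measurable M" by (rule gaussian_rv_measurable[OF g])
  show "integrable M (B r t)" "integrable M (\<lambda>\<omega>. (B r t \<omega>)\<^sup>2)"
    by (rule gaussian_rv_integrable[OF prob_space_axioms g])+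
qed

lemma expectation_B: "r \<in> {1..m} \<Longrightarrow> t \<ge> 0 \<Longrightarrow> expectation (B r t) = 0"
  using B[of r] by (simp add: fractional_brownian_motion_def)

text \<open>Independence is assumed for whole paths; both later uses, single values and grid
  combinations, are measurable functionals of a path.\<close>

lemma indep_functionals:
  assumes "\<And>r. r \<in> {1..m} \<Longrightarrow> f r \<in> borel_measurable (Pi\<^sub>M {0..} (\<lambda>_. borel))"
  shows "indep_vars (\<lambda>_. borel) (\<lambda>r \<omega>. f r (\<lambda>t\<in>{0..}. B r t \<omega>)) {1..m}"
  using indep unfolding indep_processes_def by (rule indep_vars_compose2) (rule assms)

lemma expectation_B_mult:
  assumes r: "r \<in> {1..m}" "q \<in> {1..m}" and st: "s \<ge> 0" "t \<ge> 0"
  shows "expectation (\<lambda>\<omega>. B r s \<omega> * B q t \<omega>) = (if r = q then fbm_cov (H r) s t else 0)"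
proof (cases "r = q")
  case True
  have "expectation (\<lambda>\<omega>. B r s \<omega> * B r t \<omega>) = fbm_cov (H r) t s"
    using B[OF r(1)] st unfolding fractional_brownian_motion_def by blast
  thus ?thesis using True by (simp add: fbm_cov_def abs_minus_commute add.commute)
next
  case False
  \<comment> \<open>One time for each process, so that the two values form a family indexed by the
    process and the product rule for independent families applies.\<close>
  define \<tau> where "\<tau> l = (if l = r then s else t)" for l
  have "indep_vars (\<lambda>_. borel) (\<lambda>l \<omega>. (\<lambda>x. x (\<tau> l)) (\<lambda>t\<in>{0..}. B l t \<omega>)) {1..m}"
    by (rule indep_functionals) (use st in \<open>auto simp: \<tau>_def intro!: measurable_component_singleton\<close>)
  hence "indep_vars (\<lambda>_. borel) (\<lambda>l \<omega>. (\<lambda>x. x (\<tau> l)) (\<lambda>t\<in>{0..}. B l t \<omega>)) {r, q}"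
    by (rule indep_vars_subset) (use r in auto)
  hence ind: "indep_vars (\<lambda>_. borel) (\<lambda>l. B l (\<tau> l)) {r, q}"
    by (rule indep_vars_cong[THEN iffD1, rotated -1]) (use st in \<open>auto simp: \<tau>_def\<close>)
  have "expectation (\<lambda>\<omega>. \<Prod>l\<in>{r, q}. B l (\<tau> l) \<omega>) = (\<Prod>l\<in>{r, q}. expectation (B l (\<tau> l)))"
    by (rule indep_vars_lebesgue_integral[OF _ ind])
       (use r st in \<open>auto simp: \<tau>_def intro: B_square_integrable\<close>)
  thus ?thesis using False expectation_B r st by (simp add: \<tau>_def)
qed

section \<open>The observed noise as a centred Gaussian sequence\<close>

definition X :: "nat \<Rightarrow> 'a \<Rightarrow> real" where
  "X i \<omega> = (\<Sum>r=1..m. B r (grid h i) \<omega>)"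

lemma grid_pos: "grid h i > 0"
  using h by (simp add: grid_def)

lemma grid_nonneg: "grid h i \<ge> 0"
  using grid_pos by (rule less_imp_le)

lemma grid_inj: "inj_on (grid h) S"
  using h by (auto simp: inj_on_def grid_def)

lemma integrable_B_mult:
  assumes "r \<in> {1..m}" "q \<in> {1..m}"
  shows "integrable M (\<lambda>\<omega>. B r (grid h i) \<omega> * B q (grid h j) \<omega>)"
  by (intro integrable_mult_of_sq B_square_integrable assms grid_nonneg)

lemma integrable_X_mult: "integrable M (\<lambda>\<omega>. X i \<omega> * X j \<omega>)"
  unfolding X_def sum_product by (intro Bochner_Integration.integrable_sum integrable_B_mult)

lemma expectation_X_mult:
  "expectation (\<lambda>\<omega>. X i \<omega> * X j \<omega>) = (\<Sum>r=1..m. fbm_cov (H r) (grid h i) (grid h j))"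
proof -
  have "expectation (\<lambda>\<omega>. X i \<omega> * X j \<omega>)
      = (\<Sum>r=1..m. \<Sum>q=1..m. expectation (\<lambda>\<omega>. B r (grid h i) \<omega> * B q (grid h j) \<omega>))"
    unfolding X_def sum_product by (intro integral_double_sum integrable_B_mult)
  also have "\<dots> = (\<Sum>r=1..m. \<Sum>q=1..m. if r = q then fbm_cov (H r) (grid h i) (grid h j) else 0)"
    by (intro sum.cong refl expectation_B_mult grid_nonneg) auto
  finally show ?thesis by simp
qed

text \<open>Grouped by process and not by time: for fixed p these are independent in r, and each is
  Gaussian as a combination of values of one process.\<close>

definition U :: "(nat \<Rightarrow>\<^sub>0 real) \<Rightarrow> nat \<Rightarrow> 'a \<Rightarrow> real" where
  "U p r \<omega> = lincomb (\<lambda>i. B r (grid h i) \<omega>) p"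

lemma lincomb_X: "lincomb (\<lambda>i. X i \<omega>) p = (\<Sum>r=1..m. U p r \<omega>)"
  unfolding lincomb_def X_def U_def sum_distrib_left by (rule sum.swap)

lemma gaussian_U:
  assumes r: "r \<in> {1..m}"
  shows "gaussian_rv M (U p r)"
proof -
  \<comment> \<open>\<open>gaussian_B\<close> sums over a set of times, so the coefficient of a time
    is looked up through the inverse of the injective grid.\<close>
  define c where "c t = Poly_Mapping.lookup p (the_inv (grid h) t)" for t
  have "gaussian_rv M (\<lambda>\<omega>. \<Sum>t\<in>grid h ` Poly_Mapping.keys p. c t * B r t \<omega>)"
    by (rule gaussian_B[OF r]) (auto simp: grid_nonneg)
  also have "(\<lambda>\<omega>. \<Sum>t\<in>grid h ` Poly_Mapping.keys p. c t * B r t \<omega>) = U p r"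
    using grid_inj[of UNIV] by (simp add: fun_eq_iff U_def lincomb_def sum.reindex[OF grid_inj] c_def the_inv_f_f)
  finally show ?thesis .
qed

lemma measurable_U: "r \<in> {1..m} \<Longrightarrow> U p r \<in> borel_measurable M"
  by (rule gaussian_rv_measurable[OF gaussian_U])

lemma expectation_U: "r \<in> {1..m} \<Longrightarrow> expectation (U p r) = 0"
proof -
  assume r: "r \<in> {1..m}"
  have "expectation (U p r) = (\<Sum>i\<in>Poly_Mapping.keys p. expectation (\<lambda>\<omega>. Poly_Mapping.lookup p i * B r (grid h i) \<omega>))"
    unfolding U_def lincomb_def
    by (intro Bochner_Integration.integral_sum integrable_mult_right B_square_integrable(2)[OF r grid_nonneg])
  thus ?thesis using expectation_B[OF r grid_nonneg] by simp
qed

lemma integrable_U_sq: "r \<in> {1..m} \<Longrightarrow> integrable M (\<lambda>\<omega>. (U p r \<omega>)\<^sup>2)"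
  by (rule gaussian_rv_integrable(2)[OF prob_space_axioms gaussian_U])

lemma expectation_U_mult:
  assumes "r \<in> {1..m}" "q \<in> {1..m}" "r \<noteq> q"
  shows "expectation (\<lambda>\<omega>. U p r \<omega> * U p q \<omega>) = 0"
proof -
  have "expectation (\<lambda>\<omega>. U p r \<omega> * U p q \<omega>)
      = (\<Sum>i\<in>Poly_Mapping.keys p. \<Sum>j\<in>Poly_Mapping.keys p. expectation (\<lambda>\<omega>. (Poly_Mapping.lookup p i * Poly_Mapping.lookup p j) *
          (B r (grid h i) \<omega> * B q (grid h j) \<omega>)))"
    unfolding U_def lincomb_def sum_product mult.assoc mult.left_commute[of "B _ _ _" "Poly_Mapping.lookup _ _"]
    by (intro integral_double_sum integrable_mult_right integrable_B_mult assms)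
  also have "\<dots> = 0" using assms by (simp add: expectation_B_mult grid_nonneg)
  finally show ?thesis .
qed

lemma expectation_lincomb_sq:
  "expectation (\<lambda>\<omega>. (lincomb (\<lambda>i. X i \<omega>) p)\<^sup>2) = (\<Sum>r=1..m. expectation (\<lambda>\<omega>. (U p r \<omega>)\<^sup>2))"
proof -
  have int: "integrable M (\<lambda>\<omega>. U p r \<omega> * U p q \<omega>)" if "r \<in> {1..m}" "q \<in> {1..m}" for r q
    using that by (intro integrable_mult_of_sq measurable_U integrable_U_sq)
  have "expectation (\<lambda>\<omega>. (lincomb (\<lambda>i. X i \<omega>) p)\<^sup>2)
      = (\<Sum>r=1..m. \<Sum>q=1..m. expectation (\<lambda>\<omega>. U p r \<omega> * U p q \<omega>))"
    unfolding lincomb_X power2_eq_square sum_product by (intro integral_double_sum int)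
  also have "\<dots> = (\<Sum>r=1..m. \<Sum>q=1..m. if r = q then expectation (\<lambda>\<omega>. (U p r \<omega>)\<^sup>2) else 0)"
    by (intro sum.cong) (auto simp: power2_eq_square expectation_U_mult)
  finally show ?thesis by simp
qed

lemma indep_U: "indep_vars (\<lambda>_. borel) (U p) {1..m}"
proof -
  have "indep_vars (\<lambda>_. borel) (\<lambda>r \<omega>. (\<lambda>x. lincomb (\<lambda>i. x (grid h i)) p) (\<lambda>t\<in>{0..}. B r t \<omega>)) {1..m}"
    by (rule indep_functionals)
       (auto simp: lincomb_def grid_nonneg intro!: borel_measurable_sum borel_measurable_times measurable_component_singleton)
  thus ?thesis
    by (rule indep_vars_cong[THEN iffD1, rotated -1]) (auto simp: U_def grid_nonneg)
qed

text \<open>Each process is Gaussian by itself; joint Gaussianity of the sum comes from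
  independence, under which characteristic functions multiply and variances add.\<close>

sublocale centered_gaussian_sequence M X
proof unfold_locales
  fix i p
  show "X i \<in> borel_measurable M"
    unfolding X_def using grid_nonneg by (intro borel_measurable_sum B_square_integrable)
  show "integrable M (\<lambda>\<omega>. (X i \<omega>)\<^sup>2)" using integrable_X_mult by (simp add: power2_eq_square)
  have mS: "(\<lambda>\<omega>. \<Sum>r=1..m. U p r \<omega>) \<in> borel_measurable M"
    by (intro borel_measurable_sum measurable_U)
  have "(CLINT \<omega>|M. iexp (lincomb (\<lambda>i. X i \<omega>) p)) = char (distr M borel (\<lambda>\<omega>. \<Sum>r=1..m. U p r \<omega>)) 1"
    using mS by (simp add: char_def integral_distr lincomb_X)
  also have "\<dots> = (\<Prod>r=1..m. char (distr M borel (U p r)) 1)"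
    by (rule char_distr_sum[OF indep_U])
  also have "\<dots> = (\<Prod>r=1..m. complex_of_real (exp (- expectation (\<lambda>\<omega>. (U p r \<omega>)\<^sup>2) / 2)))"
  proof (intro prod.cong refl)
    fix r assume r: "r \<in> {1..m}"
    have "char (distr M borel (U p r)) 1 = (CLINT \<omega>|M. iexp (U p r \<omega>))"
      using measurable_U[OF r] by (simp add: char_def integral_distr)
    thus "char (distr M borel (U p r)) 1 = complex_of_real (exp (- expectation (\<lambda>\<omega>. (U p r \<omega>)\<^sup>2) / 2))"
      using gaussian_rv_char[OF prob_space_axioms gaussian_U[OF r] expectation_U[OF r]] by simp
  qed
  also have "\<dots> = complex_of_real (exp (\<Sum>r=1..m. - expectation (\<lambda>\<omega>. (U p r \<omega>)\<^sup>2) / 2))"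
    by (simp add: exp_sum)
  also have "(\<Sum>r=1..m. - expectation (\<lambda>\<omega>. (U p r \<omega>)\<^sup>2) / 2) = - expectation (\<lambda>\<omega>. (lincomb (\<lambda>i. X i \<omega>) p)\<^sup>2) / 2"
    by (simp add: expectation_lincomb_sq sum_negf sum_divide_distrib)
  finally show "(CLINT \<omega>|M. iexp (lincomb (\<lambda>i. X i \<omega>) p))
      = complex_of_real (exp (- expectation (\<lambda>\<omega>. (lincomb (\<lambda>i. X i \<omega>) p)\<^sup>2) / 2))" .
qed

lemma cov_single:
  "cov (Poly_Mapping.single i 1) (Poly_Mapping.single j 1) = (\<Sum>r=1..m. fbm_cov (H r) (grid h i) (grid h j))"
  unfolding cov_def lincomb_single mult_1 by (rule expectation_X_mult)

section \<open>Stationary increments and positive definiteness\<close>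

definition increment :: "nat \<Rightarrow> nat \<Rightarrow>\<^sub>0 real" where
  "increment k = (case k of 0 \<Rightarrow> Poly_Mapping.single 0 1
    | Suc l \<Rightarrow> Poly_Mapping.single (Suc l) 1 - Poly_Mapping.single l 1)"

text \<open>A sum of covariances of fractional Gaussian noises: second differences of a power
  function in i - j alone, which is stationarity, scaled by \<open>h powr (2 * H r)\<close>, which
  is self-similarity.\<close>

lemma cov_increment:
  "cov (increment i) (increment j) = (\<Sum>r=1..m. h powr (2 * H r) / 2 *
    (\<bar>real i + 1 - real j\<bar> powr (2 * H r) + \<bar>real i - real j - 1\<bar> powr (2 * H r) - 2 * \<bar>real i - real j\<bar> powr (2 * H r)))"
proof -
  \<comment> \<open>The covariance kernel on all multiples of h, including time 0, where it
    vanishes; with it the first increment, from 0 to h, obeys the same formula as the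
    others.\<close>
  define K where "K k l = (\<Sum>r=1..m. fbm_cov (H r) (real k * h) (real l * h))" for k l
  have K0: "K 0 l = 0" "K l 0 = 0" for l using h by (simp_all add: K_def fbm_cov_def abs_mult)
  have KS: "cov (Poly_Mapping.single k 1) (Poly_Mapping.single l 1) = K (Suc k) (Suc l)" for k l
    unfolding cov_single K_def grid_def ..
  have "cov (increment i) (increment j) = K (Suc i) (Suc j) - K (Suc i) j - K i (Suc j) + K i j"
    by (cases i; cases j) (simp_all add: increment_def bilinear_simps KS K0 del: single_one)
  also have "\<dots> = (\<Sum>r=1..m. fbm_cov (H r) (real (Suc i) * h) (real (Suc j) * h) - fbm_cov (H r) (real (Suc i) * h) (real j * h)
      - fbm_cov (H r) (real i * h) (real (Suc j) * h) + fbm_cov (H r) (real i * h) (real j * h))"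
    unfolding K_def by (simp add: sum.distrib sum_subtractf)
  also have "\<dots> = (\<Sum>r=1..m. h powr (2 * H r) / 2 *
    (\<bar>real i + 1 - real j\<bar> powr (2 * H r) + \<bar>real i - real j - 1\<bar> powr (2 * H r) - 2 * \<bar>real i - real j\<bar> powr (2 * H r)))"
  proof (intro sum.cong refl)
    fix r
    have abs: "\<bar>real k * h - real l * h\<bar> powr (2 * H r) = h powr (2 * H r) * \<bar>real k - real l\<bar> powr (2 * H r)" for k l
    proof -
      have "real k * h - real l * h = h * (real k - real l)" by (simp add: algebra_simps)
      thus ?thesis using h by (simp only: abs_mult powr_mult abs_of_pos)
    qed
    have eqs: "real (Suc i) - real j = real i + 1 - real j" "real i - real (Suc j) = real i - real j - 1"
      "real (Suc i) - real (Suc j) = real i - real j" by simp_all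
    have collect: "(c * x + c * y - c * z - c * z) / 2 = c / 2 * (x + y - 2 * z)" for c x y z :: real
      by (simp add: field_simps)
    show "fbm_cov (H r) (real (Suc i) * h) (real (Suc j) * h) - fbm_cov (H r) (real (Suc i) * h) (real j * h)
      - fbm_cov (H r) (real i * h) (real (Suc j) * h) + fbm_cov (H r) (real i * h) (real j * h)
      = h powr (2 * H r) / 2 *
    (\<bar>real i + 1 - real j\<bar> powr (2 * H r) + \<bar>real i - real j - 1\<bar> powr (2 * H r) - 2 * \<bar>real i - real j\<bar> powr (2 * H r))"
      unfolding fbm_cov_increments abs eqs by (rule collect)
  qed
  finally show ?thesis .
qed

lemma cov_positive_definite:
  assumes "p \<noteq> 0"
  shows "0 < cov p p"
proof (rule cov_pos[OF _ _ _ _ _ assms])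
  show "increment 0 = Poly_Mapping.single 0 1" by (simp add: increment_def)
  show "increment (Suc k) = Poly_Mapping.single (Suc k) 1 - Poly_Mapping.single k 1" for k
    by (simp add: increment_def)
  show "cov (increment (i + q)) (increment (j + q)) = cov (increment i) (increment j)" for i j q
    unfolding cov_increment by (simp add: algebra_simps)
  \<comment> \<open>At lag 0 the bracket is 1 + 1 - 0, so this is the sum of the
    \<open>h powr (2 * H r)\<close>, nonempty because m \<ge> 1.\<close>
  show "0 < cov (increment 0) (increment 0)"
    unfolding cov_increment using h m by (intro sum_pos) auto
  have "(\<lambda>n. cov (increment n) (increment 0)) \<longlonglongrightarrow> (\<Sum>r=1..m. h powr (2 * H r) / 2 * 0)"
    unfolding cov_increment
  proof (intro tendsto_sum tendsto_mult tendsto_const)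
    fix r assume "r \<in> {1..m}"
    hence "1 < 2 * H r" "2 * H r < 2" using H[of r] by auto
    from powr_second_difference_tendsto_0[OF this]
    show "(\<lambda>n. \<bar>real n + 1 - real 0\<bar> powr (2 * H r) + \<bar>real n - real 0 - 1\<bar> powr (2 * H r)
        - 2 * \<bar>real n - real 0\<bar> powr (2 * H r)) \<longlonglongrightarrow> 0" by simp
  qed
  thus "(\<lambda>n. cov (increment n) (increment 0)) \<longlonglongrightarrow> 0" by simp
qed

end

section \<open>The estimator\<close>

text \<open>One-sided inverses of square matrices are two-sided, so with G the covariance matrix, G
  A^T is inverse to A from both sides and the product can be rotated to G (A^T A) = 1.\<close>

lemma prec_mat_eq:
  assumes A: "A \<in> carrier_mat N N" and inv: "A * sum_cov_mat m H h N * transpose_mat A = 1\<^sub>m N"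
  shows "prec_mat m H h N = transpose_mat A * A"
proof -
  let ?G = "sum_cov_mat m H h N" and ?T = "transpose_mat A"
  have G: "?G \<in> carrier_mat N N" by (simp add: sum_cov_mat_def)
  have T: "?T \<in> carrier_mat N N" using A by simp
  have "A * (?G * ?T) = 1\<^sub>m N" using inv A G T by (simp add: assoc_mult_mat)
  hence "(?G * ?T) * A = 1\<^sub>m N" by (rule mat_mult_left_right_inverse[OF A mult_carrier_mat[OF G T]])
  hence GP: "?G * (?T * A) = 1\<^sub>m N" using A G T by (simp add: assoc_mult_mat)
  have TA: "?T * A \<in> carrier_mat N N" using A T by simp
  have PG: "(?T * A) * ?G = 1\<^sub>m N" by (rule mat_mult_left_right_inverse[OF G TA GP])
  show ?thesis
  proof (cases "mat_inverse ?G")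
    \<comment> \<open>Here \<open>prec_mat\<close> would be \<open>the None\<close>; the case is
      excluded because \<open>GP\<close> and \<open>PG\<close> make the matrix a unit.\<close>
    case None
    hence "?G \<notin> Units (ring_mat TYPE(real) N ())" by (rule mat_inverse(1)[OF G])
    moreover have "?G \<in> Units (ring_mat TYPE(real) N ())"
      unfolding Units_def ring_mat_simps using G TA GP PG by blast
    ultimately show ?thesis by contradiction
  next
    case (Some P)
    from mat_inverse(2)[OF G this] have P: "P * ?G = 1\<^sub>m N" "P \<in> carrier_mat N N" by auto
    have "P = P * (?G * (?T * A))" using GP P by simp
    also have "\<dots> = (P * ?G) * (?T * A)" by (rule assoc_mult_mat[symmetric, OF P(2) G TA])
    also have "\<dots> = ?T * A" using P(1) left_mult_one_mat[OF TA] by simp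
    finally show ?thesis using Some by (simp add: prec_mat_def)
  qed
qed

lemma scalar_prod_gram_mult:
  fixes A :: "real Matrix.mat"
  assumes A: "A \<in> carrier_mat N N" and x: "x \<in> carrier_vec N" and y: "y \<in> carrier_vec N"
  shows "Matrix.scalar_prod x ((transpose_mat A * A) *\<^sub>v y) = Matrix.scalar_prod (A *\<^sub>v x) (A *\<^sub>v y)"
proof -
  have Ax: "A *\<^sub>v x \<in> carrier_vec N" and Ay: "A *\<^sub>v y \<in> carrier_vec N" using A x y by auto
  have "Matrix.scalar_prod x ((transpose_mat A * A) *\<^sub>v y) = Matrix.scalar_prod x (transpose_mat A *\<^sub>v (A *\<^sub>v y))"
    using A y by (subst assoc_mult_mat_vec) auto
  also have "\<dots> = Matrix.scalar_prod (transpose_mat A *\<^sub>v (A *\<^sub>v y)) x"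
    using A x Ay by (intro comm_scalar_prod[of _ N]) auto
  also have "\<dots> = Matrix.scalar_prod (A *\<^sub>v y) (A *\<^sub>v x)"
    by (rule transpose_vec_mult_scalar[OF A x Ay])
  also have "\<dots> = Matrix.scalar_prod (A *\<^sub>v x) (A *\<^sub>v y)"
    by (rule comm_scalar_prod[OF Ay Ax])
  finally show ?thesis .
qed

context fbm_sum
begin

lemma cov_expand:
  assumes "Poly_Mapping.keys p \<subseteq> {..<N}" "Poly_Mapping.keys q \<subseteq> {..<N}"
  shows "cov p q = (\<Sum>k<N. \<Sum>l<N. Poly_Mapping.lookup p k * Poly_Mapping.lookup q l *
    (\<Sum>r=1..m. fbm_cov (H r) (grid h k) (grid h l)))"
proof -
  have "cov p q = expectation (\<lambda>\<omega>. \<Sum>k<N. \<Sum>l<N. (Poly_Mapping.lookup p k * Poly_Mapping.lookup q l) * (X k \<omega> * X l \<omega>))"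
    unfolding cov_def using assms
    by (simp add: lincomb_superset[of "{..<N}"] sum_product mult_ac)
  also have "\<dots> = (\<Sum>k<N. \<Sum>l<N. expectation (\<lambda>\<omega>. (Poly_Mapping.lookup p k * Poly_Mapping.lookup q l) * (X k \<omega> * X l \<omega>)))"
    by (intro integral_double_sum integrable_mult_right integrable_X_mult)
  finally show ?thesis by (simp add: expectation_X_mult)
qed

text \<open>The subtracted term is the squared length of the projection of A z onto A T. As A T lies
  on the last axis, only the drift-free coordinates survive. \<open>Y\<close> is obtained before
  \<theta> and \<alpha> are quantified, so one family serves all parameters.\<close>

lemma alpha_sq_est_chi_square:
  assumes N: "N \<ge> 1"
  obtains Y where "std_gaussian_family M (N - 1) Y"
    and "\<And>\<theta> \<alpha> \<omega>. alpha_sq_est m H h N (obs_vec h N (mixed_fbm m \<theta> \<alpha> B) \<omega>)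
           = \<alpha>\<^sup>2 / real N * (\<Sum>i<N - 1. (Y i \<omega>)\<^sup>2)"
proof -
  obtain e where on: "\<And>i j. i < N \<Longrightarrow> j < N \<Longrightarrow> cov (e i) (e j) = (if i = j then 1 else 0)"
    and ke: "\<And>i. i < N \<Longrightarrow> Poly_Mapping.keys (e i) \<subseteq> {..<N}"
    and e0: "\<And>i. i < N - 1 \<Longrightarrow> lincomb (grid h) (e i) = 0"
    and el: "lincomb (grid h) (e (N - 1)) \<noteq> 0"
    using orthonormal_contrasts[OF cov_positive_definite h N] by blast
  define Y where "Y i \<omega> = lincomb (\<lambda>k. X k \<omega>) (e i)" for i \<omega>
  define A where "A = Matrix.mat N N (\<lambda>(i, j). Poly_Mapping.lookup (e i) j)"
  have A: "A \<in> carrier_mat N N" by (simp add: A_def)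
  have entry: "(A *\<^sub>v Matrix.vec N z) $ i = lincomb z (e i)" if "i < N" for z i
    using that ke[OF that]
    by (simp add: A_def scalar_prod_def lincomb_superset[of "{..<N}"] atLeast0LessThan)
  have "A * sum_cov_mat m H h N * transpose_mat A = 1\<^sub>m N"
  proof (rule eq_matI)
    fix i j assume ij: "i < dim_row (1\<^sub>m N)" "j < dim_col (1\<^sub>m N)"
    hence "(A * sum_cov_mat m H h N * transpose_mat A) $$ (i, j)
        = (\<Sum>l<N. (\<Sum>k<N. Poly_Mapping.lookup (e i) k * (\<Sum>r=1..m. fbm_cov (H r) (grid h k) (grid h l))) * Poly_Mapping.lookup (e j) l)"
      by (simp add: A_def sum_cov_mat_def fbm_cov_mat_def scalar_prod_def atLeast0LessThan)
    also have "\<dots> = (\<Sum>k<N. \<Sum>l<N. Poly_Mapping.lookup (e i) k * Poly_Mapping.lookup (e j) l * (\<Sum>r=1..m. fbm_cov (H r) (grid h k) (grid h l)))"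
      unfolding sum_distrib_right[of _ "{..<N}"] by (subst sum.swap) (simp only: mult_ac)
    also have "\<dots> = cov (e i) (e j)" using ij by (intro cov_expand[symmetric] ke) auto
    finally show "(A * sum_cov_mat m H h N * transpose_mat A) $$ (i, j) = 1\<^sub>m N $$ (i, j)"
      using ij on by simp
  qed (simp_all add: A_def)
  hence P: "prec_mat m H h N = transpose_mat A * A" by (rule prec_mat_eq[OF A])
  define \<tau> where "\<tau> = lincomb (grid h) (e (N - 1))"
  have \<tau>: "\<tau> \<noteq> 0" using el by (simp add: \<tau>_def)
  have form: "Matrix.scalar_prod (Matrix.vec N x) (prec_mat m H h N *\<^sub>v Matrix.vec N y)
      = (\<Sum>i<N. lincomb x (e i) * lincomb y (e i))" for x y
  proof -
    have "Matrix.scalar_prod (Matrix.vec N x) (prec_mat m H h N *\<^sub>v Matrix.vec N y)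
        = Matrix.scalar_prod (A *\<^sub>v Matrix.vec N x) (A *\<^sub>v Matrix.vec N y)"
      unfolding P by (rule scalar_prod_gram_mult[OF A]) auto
    also have "\<dots> = (\<Sum>i<N. (A *\<^sub>v Matrix.vec N x) $ i * (A *\<^sub>v Matrix.vec N y) $ i)"
      using A by (simp only: scalar_prod_def atLeast0LessThan dim_mult_mat_vec carrier_matD)
    also have "\<dots> = (\<Sum>i<N. lincomb x (e i) * lincomb y (e i))"
      by (intro sum.cong refl) (simp only: entry lessThan_iff)
    finally show ?thesis .
  qed
  have split: "(\<Sum>i<N. f i) = (\<Sum>i<N - 1. f i) + f (N - 1)" for f :: "nat \<Rightarrow> real"
    using N sum.lessThan_Suc[of f "N - 1"] by simp
  have drift: "Matrix.scalar_prod (time_vec h N) (prec_mat m H h N *\<^sub>v Matrix.vec N y) = \<tau> * lincomb y (e (N - 1))" for y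
    unfolding time_vec_def form split by (simp add: e0 \<tau>_def)
  have d: "d_coeff m H h N = \<tau>\<^sup>2"
    unfolding d_coeff_def using drift[of "grid h"] by (simp add: time_vec_def \<tau>_def power2_eq_square)
  \<comment> \<open>The subtracted term is (\<tau> x)^2 / \<tau>^2 with x the last coordinate; since
    \<open>\<tau> \<noteq> 0\<close> it cancels the last square.\<close>
  have reduce: "alpha_sq_est m H h N (Matrix.vec N z) = 1 / real N * (\<Sum>i<N - 1. (lincomb z (e i))\<^sup>2)" for z
    unfolding alpha_sq_est_def drift d form split[of "\<lambda>i. lincomb z (e i) * lincomb z (e i)"]
    using \<tau> by (simp add: power2_eq_square)
  show thesis
  proof
    show "std_gaussian_family M (N - 1) Y"
      unfolding Y_def by (rule std_gaussian_family_orthonormal) (use on in auto)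
    fix \<theta> \<alpha> \<omega>
    have "lincomb (\<lambda>i. mixed_fbm m \<theta> \<alpha> B (grid h i) \<omega>) (e i) = \<alpha> * Y i \<omega>" if "i < N - 1" for i
    proof -
      have "mixed_fbm m \<theta> \<alpha> B (grid h k) \<omega> = \<theta> * grid h k + \<alpha> * X k \<omega>" for k
        by (simp add: mixed_fbm_def X_def)
      thus ?thesis using e0[OF that] by (simp add: lincomb_affine Y_def)
    qed
    thus "alpha_sq_est m H h N (obs_vec h N (mixed_fbm m \<theta> \<alpha> B) \<omega>) = \<alpha>\<^sup>2 / real N * (\<Sum>i<N - 1. (Y i \<omega>)\<^sup>2)"
      unfolding obs_vec_def reduce by (simp add: power_mult_distrib flip: sum_distrib_left)
  qed
qed

text \<open>With n = N - 1 degrees of freedom, n (n + 2) becomes (N - 1) (N + 1). In the third claim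
  the sign of \<alpha> turns the square root of its square into \<alpha>.\<close>

lemma alpha_sq_est_moments:
  fixes \<theta> \<alpha> :: real
  assumes N: "N \<ge> 2" and \<alpha>: "\<alpha> > 0"
  defines "A2 \<equiv> \<lambda>\<omega>. alpha_sq_est m H h N (obs_vec h N (mixed_fbm m \<theta> \<alpha> B) \<omega>)"
  shows "has_bochner_integral M A2 ((real N - 1) / real N * \<alpha>\<^sup>2)"
    and "has_bochner_integral M (\<lambda>\<omega>. (A2 \<omega>)\<^sup>2) ((real N - 1) * (real N + 1) / (real N)\<^sup>2 * \<alpha> ^ 4)"
    and "has_bochner_integral M (\<lambda>\<omega>. sqrt (A2 \<omega>)) (b_coeff N * \<alpha>)"
proof -
  obtain Y where Y: "std_gaussian_family M (N - 1) Y"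
    and "\<And>\<theta> \<alpha> \<omega>. alpha_sq_est m H h N (obs_vec h N (mixed_fbm m \<theta> \<alpha> B) \<omega>)
           = \<alpha>\<^sup>2 / real N * (\<Sum>i<N - 1. (Y i \<omega>)\<^sup>2)"
    using alpha_sq_est_chi_square[of N] N by auto
  hence A2: "A2 = (\<lambda>\<omega>. \<alpha>\<^sup>2 / real N * (\<Sum>i<N - 1. (Y i \<omega>)\<^sup>2))" by (simp add: A2_def)
  have n: "real (N - 1) = real N - 1" using N by simp
  note mom = std_gaussian_family_chi_square_moments[OF prob_space_axioms Y, unfolded n]
  have "has_bochner_integral M A2 (\<alpha>\<^sup>2 / real N * (real N - 1))"
    unfolding A2 by (rule has_bochner_integral_mult_right[OF mom(1)])
  thus "has_bochner_integral M A2 ((real N - 1) / real N * \<alpha>\<^sup>2)" by (simp add: mult.commute)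
  have "has_bochner_integral M (\<lambda>\<omega>. (A2 \<omega>)\<^sup>2) ((\<alpha>\<^sup>2 / real N)\<^sup>2 * ((real N - 1) * (real N - 1 + 2)))"
    unfolding A2 power_mult_distrib[of "\<alpha>\<^sup>2 / real N"] by (rule has_bochner_integral_mult_right[OF mom(2)])
  thus "has_bochner_integral M (\<lambda>\<omega>. (A2 \<omega>)\<^sup>2) ((real N - 1) * (real N + 1) / (real N)\<^sup>2 * \<alpha> ^ 4)"
    by (simp add: power_divide mult.commute add.commute flip: power_mult)
  have "has_bochner_integral M (\<lambda>\<omega>. sqrt (\<Sum>i<N - 1. (Y i \<omega>)\<^sup>2))
      (sqrt 2 * Gamma ((real N - 1) / 2 + 1/2) / Gamma ((real N - 1) / 2))"
    using std_gaussian_family_chi_moment[OF prob_space_axioms Y, unfolded n] N by simp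
  from has_bochner_integral_mult_right[OF this, of "\<alpha> / sqrt (real N)"]
  have "has_bochner_integral M (\<lambda>\<omega>. \<alpha> / sqrt (real N) * sqrt (\<Sum>i<N - 1. (Y i \<omega>)\<^sup>2))
      (\<alpha> / sqrt (real N) * (sqrt 2 * Gamma ((real N - 1) / 2 + 1/2) / Gamma ((real N - 1) / 2)))" by simp
  moreover have arg: "(real N - 1) / 2 + 1/2 = real N / 2" by (simp add: field_simps)
  have "\<alpha> / sqrt (real N) * (sqrt 2 * Gamma ((real N - 1) / 2 + 1/2) / Gamma ((real N - 1) / 2)) = b_coeff N * \<alpha>"
    unfolding arg b_coeff_def by (simp add: real_sqrt_divide)
  moreover have "\<alpha> / sqrt (real N) * sqrt (\<Sum>i<N - 1. (Y i \<omega>)\<^sup>2) = sqrt (A2 \<omega>)" for \<omega>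
    using \<alpha> by (simp add: A2 real_sqrt_mult real_sqrt_divide)
  ultimately show "has_bochner_integral M (\<lambda>\<omega>. sqrt (A2 \<omega>)) (b_coeff N * \<alpha>)" by simp
qed

end

theorem corollary3p8:
  fixes M :: "'a measure"
    and m :: nat
    and H :: "nat \<Rightarrow> real"
    and B :: "nat \<Rightarrow> real \<Rightarrow> 'a \<Rightarrow> real"
    and h \<theta> \<alpha> :: real
  defines "Z \<equiv> mixed_fbm m \<theta> \<alpha> B"
  defines "A2 \<equiv> \<lambda>N \<omega>. alpha_sq_est m H h N (obs_vec h N Z \<omega>)"
    and "A \<equiv> \<lambda>N \<omega>. alpha_est m H h N (obs_vec h N Z \<omega>)"
    and "A2c \<equiv> \<lambda>N \<omega>. alpha_sq_est_corrected m H h N (obs_vec h N Z \<omega>)"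
  assumes "prob_space M"
    and "h > 0" and "m \<ge> 1"
    and "\<And>r. r \<in> {1..m} \<Longrightarrow> 1 / 2 < H r \<and> H r < 1"
    and "\<And>r. r \<in> {1..m} \<Longrightarrow> fractional_brownian_motion M (H r) (B r)"
    and "indep_processes M B {1..m}"
    and "\<alpha> > 0"
  shows "(\<forall>N\<ge>2.
            integrable M (A2 N) \<and> integrable M (\<lambda>\<omega>. (A2 N \<omega>)\<^sup>2) \<and> integrable M (A N) \<and>
            prob_space.expectation M (A2 N) = (real N - 1) / real N * \<alpha>\<^sup>2 \<and>
            prob_space.expectation M (A2 N) - \<alpha>\<^sup>2 = - (\<alpha>\<^sup>2 / real N) \<and>
            prob_space.variance M (A2 N) = 2 * (real N - 1) / (real N)\<^sup>2 * \<alpha> ^ 4 \<and>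
            prob_space.expectation M (\<lambda>\<omega>. (A2 N \<omega> - \<alpha>\<^sup>2)\<^sup>2)
              = (2 * real N - 1) / (real N)\<^sup>2 * \<alpha> ^ 4 \<and>
            prob_space.expectation M (A N) = b_coeff N * \<alpha> \<and>
            0 < b_coeff N \<and> b_coeff N < 1)
       \<and> mono_on {2..} b_coeff \<and> b_coeff \<longlonglongrightarrow> 1
       \<and> (\<forall>N\<ge>2. prob_space.expectation M (A2 N) \<noteq> \<alpha>\<^sup>2)
       \<and> (\<lambda>N. prob_space.expectation M (A2 N)) \<longlonglongrightarrow> \<alpha>\<^sup>2
       \<and> (\<forall>N\<ge>2. prob_space.expectation M (A2c N) = \<alpha>\<^sup>2 \<and>
                 prob_space.variance M (A2c N) = 2 * \<alpha> ^ 4 / (real N - 1))"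
proof -
  interpret fbm_sum M m H B h
    using assms by (intro fbm_sum.intro fbm_sum_axioms.intro) auto
  have mom: "has_bochner_integral M (A2 N) ((real N - 1) / real N * \<alpha>\<^sup>2)"
      "has_bochner_integral M (\<lambda>\<omega>. (A2 N \<omega>)\<^sup>2) ((real N - 1) * (real N + 1) / (real N)\<^sup>2 * \<alpha> ^ 4)"
      "has_bochner_integral M (A N) (b_coeff N * \<alpha>)" if "N \<ge> 2" for N
    unfolding A2_def A_def Z_def alpha_est_def by (rule alpha_sq_est_moments[OF that \<open>\<alpha> > 0\<close>])+
  have int: "integrable M (A2 N)" "integrable M (\<lambda>\<omega>. (A2 N \<omega>)\<^sup>2)" "integrable M (A N)" if "N \<ge> 2" for N
    using mom[OF that] by (auto intro: integrable.intros)
  have E: "expectation (A2 N) = (real N - 1) / real N * \<alpha>\<^sup>2"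
      "expectation (\<lambda>\<omega>. (A2 N \<omega>)\<^sup>2) = (real N - 1) * (real N + 1) / (real N)\<^sup>2 * \<alpha> ^ 4"
      "expectation (A N) = b_coeff N * \<alpha>" if "N \<ge> 2" for N
    using mom[OF that] by (auto intro: has_bochner_integral_integral_eq)
  have bias: "expectation (A2 N) - \<alpha>\<^sup>2 = - (\<alpha>\<^sup>2 / real N)" if "N \<ge> 2" for N
    using that by (simp add: E field_simps)
  \<comment> \<open>One expansion about an arbitrary centre c: the mean gives the variance, and
    \<open>\<alpha>\<^sup>2\<close> gives the mean squared error.\<close>
  have sq: "expectation (\<lambda>\<omega>. (A2 N \<omega> - c)\<^sup>2)
      = (real N - 1) * (real N + 1) / (real N)\<^sup>2 * \<alpha> ^ 4 - 2 * c * ((real N - 1) / real N * \<alpha>\<^sup>2) + c\<^sup>2"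
    if "N \<ge> 2" for N c
  proof -
    have "expectation (\<lambda>\<omega>. (A2 N \<omega> - c)\<^sup>2) = expectation (\<lambda>\<omega>. (A2 N \<omega>)\<^sup>2 - (2 * c) * A2 N \<omega> + c\<^sup>2)"
      by (simp add: power2_diff algebra_simps)
    also have "\<dots> = expectation (\<lambda>\<omega>. (A2 N \<omega>)\<^sup>2) - 2 * c * expectation (A2 N) + c\<^sup>2"
      using int[OF that] by (simp add: prob_space)
    finally show ?thesis unfolding E[OF that] .
  qed
  have \<alpha>4: "\<alpha> ^ 4 = \<alpha>\<^sup>2 * \<alpha>\<^sup>2" by (simp flip: power_add)
  have var: "variance (A2 N) = 2 * (real N - 1) / (real N)\<^sup>2 * \<alpha> ^ 4" if "N \<ge> 2" for N
    unfolding sq[OF that] E[OF that] \<alpha>4 using that by (simp add: field_simps power2_eq_square)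
  have mse: "expectation (\<lambda>\<omega>. (A2 N \<omega> - \<alpha>\<^sup>2)\<^sup>2) = (2 * real N - 1) / (real N)\<^sup>2 * \<alpha> ^ 4" if "N \<ge> 2" for N
    unfolding sq[OF that] \<alpha>4 using that by (simp add: field_simps power2_eq_square)
  have lim: "(\<lambda>N. expectation (A2 N)) \<longlonglongrightarrow> \<alpha>\<^sup>2"
  proof (rule Lim_transform_eventually)
    show "(\<lambda>N. (real N - 1) / real N * \<alpha>\<^sup>2) \<longlonglongrightarrow> \<alpha>\<^sup>2" by real_asymp
    show "\<forall>\<^sub>F N in sequentially. (real N - 1) / real N * \<alpha>\<^sup>2 = expectation (A2 N)"
      by (rule eventually_sequentiallyI[of 2]) (simp add: E)
  qed
  have A2c: "A2c N = (\<lambda>\<omega>. real N / (real N - 1) * A2 N \<omega>)" for N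
    by (simp add: A2c_def A2_def alpha_sq_est_corrected_def)
  have corrected: "expectation (A2c N) = \<alpha>\<^sup>2" "variance (A2c N) = 2 * \<alpha> ^ 4 / (real N - 1)" if N: "N \<ge> 2" for N
  proof -
    show "expectation (A2c N) = \<alpha>\<^sup>2" unfolding A2c using N by (simp add: E)
    have "variance (A2c N) = expectation (\<lambda>\<omega>. (real N / (real N - 1))\<^sup>2 * (A2 N \<omega> - expectation (A2 N))\<^sup>2)"
      unfolding A2c integral_mult_right_zero right_diff_distrib[symmetric] power_mult_distrib by (rule refl)
    also have "\<dots> = (real N / (real N - 1))\<^sup>2 * variance (A2 N)"
      by (rule integral_mult_right_zero)
    also have "\<dots> = 2 * \<alpha> ^ 4 / (real N - 1)"
    proof -
      have "(x / y)\<^sup>2 * (2 * y / x\<^sup>2 * a) = 2 * a / y" if "x \<noteq> 0" "y \<noteq> 0" for x y a :: real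
        using that by (simp add: field_simps power2_eq_square)
      from this[of "real N" "real N - 1"] show ?thesis
        unfolding var[OF N] using N by simp
    qed
    finally show "variance (A2c N) = 2 * \<alpha> ^ 4 / (real N - 1)" .
  qed
  have biased: "expectation (A2 N) \<noteq> \<alpha>\<^sup>2" if "N \<ge> 2" for N
    using bias[OF that] that \<open>\<alpha> > 0\<close> by auto
  show ?thesis
    by (intro conjI allI impI int E bias var mse b_coeff_pos b_coeff_less_1 b_coeff_mono
        b_coeff_tendsto biased lim corrected)
qed

end
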